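(* The smash product $\mathbb S$-algebra $H\mathbb Z\wedge H\mathbb Z$ is not isomorphic (as an $\mathbb S$-algebra) to $H\mathbb Z$.
   Context: For $k\ge 0$ let $k_+=\{0,1,\dots,k\}$, pointed by $0$. $\Gamma^{\rm op}$ is the full subcategory of the category of finite pointed sets on the objects $k_+$ (functors on $\Gamma^{\rm op}$ are evaluated on arbitrary finite pointed sets via the evident equivalence). A $\Gamma$-set is a functor $F:\Gamma^{\rm op}\to\mathrm{Sets}_*$ with $F(0_+)$ a one-point set; morphisms are natural transformations. The smash product of pointed sets $X\wedge Y$ is $X\times Y$ with $X\times\{*\}\cup\{*\}\times Y$ collapsed to the base point. The smash product of $\Gamma$-sets is the Day convolution $(F_1\wedge F_2)(Z)=\varinjlim_{v:X\wedge Y\to Z}F_1(X)\wedge F_2(Y)$; a morphism $F_1\wedge F_2\to G$ is the same as a family of pointed maps $F_1(X)\wedge F_2(Y)\to G(X\wedge Y)$ natural in $X,Y$. This is a symmetric monoidal structure with unit the inclusion functor $\mathbb S:\Gamma^{\rm op}\to\mathrm{Sets}_*$. An $\mathbb S$-algebra is a $\Gamma$-set $\mathcal A$ with an associative multiplication $\mathcal A\wedge\mathcal A\to\mathcal A$ and a unit $\mathbb S\to\mathcal A$ (a monoid in this monoidal category); morphisms are morphisms of $\Gamma$-sets compatible with product and unit. The smash product $\mathcal A\wedge\mathcal B$ of two $\mathbb S$-algebras is an $\mathbb S$-algebra with the usual product of the tensor product of two monoids in a symmetric monoidal category. $H\mathbb Z$ is the $\mathbb S$-algebra with $H\mathbb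 Z(X)=\mathbb Z^{X\setminus\{*\}}$ (base point the zero function), $H\mathbb Z(f)(\phi)(y)=\sum_{x\in f^{-1}(y)}\phi(x)$ for $f:X\to Y$ pointed and $y\ne *$, product $H\mathbb Z(X)\wedge H\mathbb Z(Y)\to H\mathbb Z(X\wedge Y)$, $(\phi\psi)(x,y)=\phi(x)\psi(y)$, and unit $X\to H\mathbb Z(X)$, $x\mapsto\delta_x$ (where $\delta_x(y)=1$ if $x=y$ and $0$ otherwise). *)

theory Defs
  imports Main
begin

section \<open>The category of the finite pointed sets \<open>k\<^sub>+\<close>\<close>

text \<open>
  The object \<open>k\<^sub>+ = {0,\<dots>,k}\<close> is encoded by the number \<open>k\<close>.  Pointed maps are functions
  on all of \<open>nat\<close>; the value 0 beyond the domain makes the encoding unique and is preserved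
  by \<open>\<circ>\<close>.
\<close>

definition gmaps :: "nat \<Rightarrow> nat \<Rightarrow> (nat \<Rightarrow> nat) set" where
  "gmaps m n = {f. f 0 = 0 \<and> (\<forall>i\<le>m. f i \<le> n) \<and> (\<forall>i>m. f i = 0)}"

definition gid :: "nat \<Rightarrow> nat \<Rightarrow> nat" where
  "gid n = (\<lambda>i. if i \<le> n then i else 0)"

text \<open>
  The smash product \<open>k\<^sub>+ \<and> l\<^sub>+\<close> is identified with \<open>(k * l)\<^sub>+\<close> by listing the pairs \<open>(i, j)\<close>,
  \<open>1 \<le> i \<le> k\<close>, \<open>1 \<le> j \<le> l\<close>, in lexicographic order; \<open>spair l i j\<close> is the image of \<open>(i, j)\<close> and
  \<open>sfst\<close>, \<open>ssnd\<close> are the inverse.  With this choice the associator and the unitors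
  of the smash product of the \<open>k\<^sub>+\<close> are identities.
\<close>

definition spair :: "nat \<Rightarrow> nat \<Rightarrow> nat \<Rightarrow> nat" where
  "spair l i j = (if i = 0 \<or> j = 0 then 0 else (i - 1) * l + j)"

definition sfst :: "nat \<Rightarrow> nat \<Rightarrow> nat" where
  "sfst l p = (if p = 0 then 0 else Suc ((p - 1) div l))"

definition ssnd :: "nat \<Rightarrow> nat \<Rightarrow> nat" where
  "ssnd l p = (if p = 0 then 0 else Suc ((p - 1) mod l))"

text \<open>\<open>f \<and> g : (k * l)\<^sub>+ \<rightarrow> (k' * l')\<^sub>+\<close> for \<open>f : k\<^sub>+ \<rightarrow> k'\<^sub>+\<close> and \<open>g : l\<^sub>+ \<rightarrow> l'\<^sub>+\<close>.\<close>

definition smash_map :: "nat \<Rightarrow> nat \<Rightarrow> (nat \<Rightarrow> nat) \<Rightarrow> (nat \<Rightarrow> nat) \<Rightarrow> nat \<Rightarrow> nat" where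
  "smash_map l l' f g = (\<lambda>p. spair l' (f (sfst l p)) (g (ssnd l p)))"

text \<open>
  The interchange \<open>(k\<^sub>+ \<and> k'\<^sub>+) \<and> (l\<^sub>+ \<and> l'\<^sub>+) \<rightarrow> (k\<^sub>+ \<and> l\<^sub>+) \<and> (k'\<^sub>+ \<and> l'\<^sub>+)\<close>,
  \<open>((a, a'), (b, b')) \<mapsto> ((a, b), (a', b'))\<close>.
\<close>

definition interchange :: "nat \<Rightarrow> nat \<Rightarrow> nat \<Rightarrow> nat \<Rightarrow> nat \<Rightarrow> nat" where
  "interchange k k' l l' = (\<lambda>p. if p \<le> (k * k') * (l * l') then
     (let q = sfst (l * l') p; r = ssnd (l * l') p in
        spair (k' * l') (spair l (sfst k' q) (sfst l' r)) (spair l' (ssnd k' q) (ssnd l' r)))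
     else 0)"

text \<open>\<open>i \<and> - : n\<^sub>+ \<rightarrow> m\<^sub>+ \<and> n\<^sub>+\<close> for \<open>i \<in> m\<^sub>+\<close>, and \<open>- \<and> j : m\<^sub>+ \<rightarrow> m\<^sub>+ \<and> n\<^sub>+\<close> for \<open>j \<in> n\<^sub>+\<close>.\<close>

definition sleft :: "nat \<Rightarrow> nat \<Rightarrow> nat \<Rightarrow> nat" where
  "sleft n i = (\<lambda>j. if j \<le> n then spair n i j else 0)"

definition sright :: "nat \<Rightarrow> nat \<Rightarrow> nat \<Rightarrow> nat \<Rightarrow> nat" where
  "sright m n j = (\<lambda>i. if i \<le> m then spair n i j else 0)"


section \<open>\<open>\<Gamma>\<close>-sets\<close>

record 'a gamma_set =
  obj :: "nat \<Rightarrow> 'a set"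
  bpt :: "nat \<Rightarrow> 'a"
  arr :: "nat \<Rightarrow> nat \<Rightarrow> (nat \<Rightarrow> nat) \<Rightarrow> 'a \<Rightarrow> 'a"

definition is_gamma_set :: "('a, 'z) gamma_set_scheme \<Rightarrow> bool" where
  "is_gamma_set F \<longleftrightarrow>
     (\<forall>n. bpt F n \<in> obj F n) \<and>
     (\<forall>m n. \<forall>f\<in>gmaps m n. \<forall>x\<in>obj F m. arr F m n f x \<in> obj F n) \<and>
     (\<forall>m n. \<forall>f\<in>gmaps m n. arr F m n f (bpt F m) = bpt F n) \<and>
     (\<forall>n. \<forall>x\<in>obj F n. arr F n n (gid n) x = x) \<and>
     (\<forall>m n p. \<forall>f\<in>gmaps m n. \<forall>g\<in>gmaps n p. \<forall>x\<in>obj F m.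
        arr F m p (g \<circ> f) x = arr F n p g (arr F m n f x)) \<and>
     obj F 0 = {bpt F 0}"

definition gamma_hom ::
  "('a, 'y) gamma_set_scheme \<Rightarrow> ('b, 'z) gamma_set_scheme \<Rightarrow> (nat \<Rightarrow> 'a \<Rightarrow> 'b) \<Rightarrow> bool" where
  "gamma_hom F G h \<longleftrightarrow>
     (\<forall>n. \<forall>x\<in>obj F n. h n x \<in> obj G n) \<and>
     (\<forall>n. h n (bpt F n) = bpt G n) \<and>
     (\<forall>m n. \<forall>f\<in>gmaps m n. \<forall>x\<in>obj F m. h n (arr F m n f x) = arr G m n f (h m x))"

text \<open>
  Families of pointed maps \<open>F(X) \<and> G(Y) \<rightarrow> H(X \<and> Y)\<close> natural in \<open>X\<close> and \<open>Y\<close>; a pointed map out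
  of a smash product is a map on the product that sends both axes to the base point.
\<close>

definition bimorphism ::
  "('a, 'x) gamma_set_scheme \<Rightarrow> ('b, 'y) gamma_set_scheme \<Rightarrow> ('c, 'z) gamma_set_scheme \<Rightarrow>
   (nat \<Rightarrow> nat \<Rightarrow> 'a \<Rightarrow> 'b \<Rightarrow> 'c) \<Rightarrow> bool" where
  "bimorphism F G H b \<longleftrightarrow>
     (\<forall>k l. \<forall>x\<in>obj F k. \<forall>y\<in>obj G l. b k l x y \<in> obj H (k * l)) \<and>
     (\<forall>k l. \<forall>y\<in>obj G l. b k l (bpt F k) y = bpt H (k * l)) \<and>
     (\<forall>k l. \<forall>x\<in>obj F k. b k l x (bpt G l) = bpt H (k * l)) \<and>
     (\<forall>k k' l l'. \<forall>f\<in>gmaps k k'. \<forall>g\<in>gmaps l l'. \<forall>x\<in>obj F k. \<forall>y\<in>obj G l.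
        b k' l' (arr F k k' f x) (arr G l l' g y) =
        arr H (k * l) (k' * l') (smash_map l l' f g) (b k l x y))"


section \<open>Day convolution\<close>

text \<open>
  The colimit defining \<open>(F \<and> G)(n\<^sub>+)\<close> is the set of the \<open>(k, l, v, x, y)\<close> with
  \<open>v : k\<^sub>+ \<and> l\<^sub>+ \<rightarrow> n\<^sub>+\<close>, \<open>x \<in> F(k\<^sub>+)\<close>, \<open>y \<in> G(l\<^sub>+)\<close>, modulo the equivalence relation generated by the
  transition maps and by the identification of the axes of all the \<open>F(k\<^sub>+) \<and> G(l\<^sub>+)\<close> with
  one base point (the colimit is taken in pointed sets).
\<close>

type_synonym ('a, 'b) day_elt = "nat \<times> nat \<times> (nat \<Rightarrow> nat) \<times> 'a \<times> 'b"

definition day_elts ::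
  "('a, 'x) gamma_set_scheme \<Rightarrow> ('b, 'y) gamma_set_scheme \<Rightarrow> nat \<Rightarrow> ('a, 'b) day_elt set" where
  "day_elts F G n = {(k, l, v, x, y). v \<in> gmaps (k * l) n \<and> x \<in> obj F k \<and> y \<in> obj G l}"

definition day_axes ::
  "('a, 'x) gamma_set_scheme \<Rightarrow> ('b, 'y) gamma_set_scheme \<Rightarrow> nat \<Rightarrow> ('a, 'b) day_elt set" where
  "day_axes F G n = {(k, l, v, x, y) \<in> day_elts F G n. x = bpt F k \<or> y = bpt G l}"

inductive day_eq ::
  "('a, 'x) gamma_set_scheme \<Rightarrow> ('b, 'y) gamma_set_scheme \<Rightarrow> nat \<Rightarrow>
   ('a, 'b) day_elt \<Rightarrow> ('a, 'b) day_elt \<Rightarrow> bool"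
  for F G n where
  transition: "\<lbrakk>f \<in> gmaps k k'; g \<in> gmaps l l'; v \<in> gmaps (k' * l') n; x \<in> obj F k; y \<in> obj G l\<rbrakk>
    \<Longrightarrow> day_eq F G n (k, l, v \<circ> smash_map l l' f g, x, y) (k', l', v, arr F k k' f x, arr G l l' g y)"
| base: "\<lbrakk>s \<in> day_axes F G n; t \<in> day_axes F G n\<rbrakk> \<Longrightarrow> day_eq F G n s t"
| refl: "t \<in> day_elts F G n \<Longrightarrow> day_eq F G n t t"
| sym: "day_eq F G n s t \<Longrightarrow> day_eq F G n t s"
| trans: "\<lbrakk>day_eq F G n s t; day_eq F G n t u\<rbrakk> \<Longrightarrow> day_eq F G n s u"

definition day_rel ::
  "('a, 'x) gamma_set_scheme \<Rightarrow> ('b, 'y) gamma_set_scheme \<Rightarrow> nat \<Rightarrow>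
   (('a, 'b) day_elt \<times> ('a, 'b) day_elt) set" where
  "day_rel F G n = {(s, t). day_eq F G n s t}"

definition day_class ::
  "('a, 'x) gamma_set_scheme \<Rightarrow> ('b, 'y) gamma_set_scheme \<Rightarrow> nat \<Rightarrow>
   ('a, 'b) day_elt \<Rightarrow> ('a, 'b) day_elt set" where
  "day_class F G n t = day_rel F G n `` {t}"

fun day_push :: "(nat \<Rightarrow> nat) \<Rightarrow> ('a, 'b) day_elt \<Rightarrow> ('a, 'b) day_elt" where
  "day_push f (k, l, v, x, y) = (k, l, f \<circ> v, x, y)"

text \<open>
  As usual, an operation on classes is the union of the classes of the results over all
  representatives; these results are all equivalent (lemmas \<open>day_arr_class\<close> and \<open>day_mul_class\<close>).
\<close>

definition day :: "('a, 'x) gamma_set_scheme \<Rightarrow> ('b, 'y) gamma_set_scheme \<Rightarrow>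
    ('a, 'b) day_elt set gamma_set" where
  "day F G = \<lparr>
     obj = (\<lambda>n. day_elts F G n // day_rel F G n),
     bpt = (\<lambda>n. day_class F G n (0, 0, (\<lambda>_. 0), bpt F 0, bpt G 0)),
     arr = (\<lambda>m n f c. \<Union>t\<in>c. day_class F G n (day_push f t)) \<rparr>"


section \<open>\<open>\<S>\<close>-algebras\<close>

text \<open>
  The product \<open>A \<and> A \<rightarrow> A\<close> is given by its natural family \<open>A(X) \<and> A(Y) \<rightarrow> A(X \<and> Y)\<close>;
  see \<open>day_factors\<close>, \<open>day_factors_unique\<close> and \<open>bimorphism_of_hom\<close> for the correspondence.
\<close>

record 'a s_algebra = "'a gamma_set" +
  mul :: "nat \<Rightarrow> nat \<Rightarrow> 'a \<Rightarrow> 'a \<Rightarrow> 'a"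
  one :: "nat \<Rightarrow> nat \<Rightarrow> 'a"

definition sphere :: "nat gamma_set" where
  "sphere = \<lparr> obj = (\<lambda>n. {0..n}), bpt = (\<lambda>n. 0), arr = (\<lambda>m n f. f) \<rparr>"

text \<open>
  In the unit laws, \<open>arr A n (m * n) (sleft n i) x\<close> is the image of \<open>(i, x)\<close> under the family
  \<open>\<S>(m\<^sub>+) \<and> A(n\<^sub>+) \<rightarrow> A(m\<^sub>+ \<and> n\<^sub>+)\<close> that corresponds to the canonical isomorphism \<open>\<S> \<and> A \<rightarrow> A\<close>.
\<close>

definition is_s_algebra :: "('a, 'z) s_algebra_scheme \<Rightarrow> bool" where
  "is_s_algebra A \<longleftrightarrow>
     is_gamma_set A \<and> bimorphism A A A (mul A) \<and> gamma_hom sphere A (one A) \<and>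
     (\<forall>k l m. \<forall>x\<in>obj A k. \<forall>y\<in>obj A l. \<forall>z\<in>obj A m.
        mul A (k * l) m (mul A k l x y) z = mul A k (l * m) x (mul A l m y z)) \<and>
     (\<forall>m n. \<forall>i\<le>m. \<forall>x\<in>obj A n. mul A m n (one A m i) x = arr A n (m * n) (sleft n i) x) \<and>
     (\<forall>m n. \<forall>j\<le>n. \<forall>x\<in>obj A m. mul A m n x (one A n j) = arr A m (m * n) (sright m n j) x)"

definition s_algebra_hom ::
  "('a, 'y) s_algebra_scheme \<Rightarrow> ('b, 'z) s_algebra_scheme \<Rightarrow> (nat \<Rightarrow> 'a \<Rightarrow> 'b) \<Rightarrow> bool" where
  "s_algebra_hom A B h \<longleftrightarrow>
     gamma_hom A B h \<and>
     (\<forall>k l. \<forall>x\<in>obj A k. \<forall>y\<in>obj A l. h (k * l) (mul A k l x y) = mul B k l (h k x) (h l y)) \<and>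
     (\<forall>n. \<forall>i\<le>n. h n (one A n i) = one B n i)"

definition s_algebra_iso ::
  "('a, 'y) s_algebra_scheme \<Rightarrow> ('b, 'z) s_algebra_scheme \<Rightarrow> bool" where
  "s_algebra_iso A B \<longleftrightarrow>
     (\<exists>h h'. s_algebra_hom A B h \<and> s_algebra_hom B A h' \<and>
        (\<forall>n. \<forall>x\<in>obj A n. h' n (h n x) = x) \<and> (\<forall>n. \<forall>y\<in>obj B n. h n (h' n y) = y))"

text \<open>
  The product of \<open>A \<and> B\<close> is \<open>(A \<and> B) \<and> (A \<and> B) \<cong> (A \<and> A) \<and> (B \<and> B) \<rightarrow> A \<and> B\<close>, the first map
  exchanging the two middle factors; its unit is \<open>\<S> \<cong> \<S> \<and> \<S> \<rightarrow> A \<and> B\<close>, where \<open>i \<in> n\<^sub>+\<close>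
  corresponds to \<open>i \<and> 1\<close> in \<open>\<S>(n\<^sub>+) \<and> \<S>(1\<^sub>+)\<close>.
\<close>

fun day_mul_elt ::
  "('a, 'y) s_algebra_scheme \<Rightarrow> ('b, 'z) s_algebra_scheme \<Rightarrow> nat \<Rightarrow>
   ('a, 'b) day_elt \<Rightarrow> ('a, 'b) day_elt \<Rightarrow> ('a, 'b) day_elt" where
  "day_mul_elt A B n (k, l, v, x, y) (k', l', v', x', y') =
     (k * k', l * l', smash_map (k' * l') n v v' \<circ> interchange k k' l l',
      mul A k k' x x', mul B l l' y y')"

definition s_smash :: "('a, 'y) s_algebra_scheme \<Rightarrow> ('b, 'z) s_algebra_scheme \<Rightarrow>
    ('a, 'b) day_elt set s_algebra" where
  "s_smash A B = gamma_set.extend (day A B) \<lparr>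
     mul = (\<lambda>m n c d. \<Union>s\<in>c. \<Union>t\<in>d. day_class A B (m * n) (day_mul_elt A B n s t)),
     one = (\<lambda>n i. day_class A B n (n, 1, gid n, one A n i, one B 1 1)) \<rparr>"


section \<open>The \<open>\<S>\<close>-algebra \<open>H\<int>\<close>\<close>

text \<open>Functions on \<open>n\<^sub>+ - {0}\<close> are encoded as functions on \<open>nat\<close> vanishing off \<open>{1..n}\<close>.\<close>

definition HZ :: "(nat \<Rightarrow> int) s_algebra" where
  "HZ = \<lparr>
     obj = (\<lambda>n. {\<phi>. \<forall>i. i \<notin> {1..n} \<longrightarrow> \<phi> i = 0}),
     bpt = (\<lambda>n. \<lambda>_. 0),
     arr = (\<lambda>m n f \<phi>. \<lambda>y. if y \<in> {1..n} then \<Sum>x | x \<in> {1..m} \<and> f x = y. \<phi> x else 0),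
     mul = (\<lambda>k l \<phi> \<psi>. \<lambda>p. if p \<in> {1..k * l} then \<phi> (sfst l p) * \<psi> (ssnd l p) else 0),
     one = (\<lambda>n i. \<lambda>j. if j \<in> {1..n} \<and> i = j then 1 else 0) \<rparr>"


section \<open>Well-definedness and consistency of the definitions\<close>

lemma s_smash_simps [simp]:
  "obj (s_smash A B) = obj (day A B)" "bpt (s_smash A B) = bpt (day A B)"
  "arr (s_smash A B) = arr (day A B)"
  "mul (s_smash A B) = (\<lambda>m n c d. \<Union>s\<in>c. \<Union>t\<in>d. day_class A B (m * n) (day_mul_elt A B n s t))"
  "one (s_smash A B) = (\<lambda>n i. day_class A B n (n, 1, gid n, one A n i, one B 1 1))"
  by (simp_all add: s_smash_def gamma_set.defs)

subsection \<open>Pairing\<close>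

lemma spair_0 [simp]: "spair l 0 j = 0" "spair l i 0 = 0"
  by (simp_all add: spair_def)

lemma sfst_0 [simp]: "sfst l 0 = 0" and ssnd_0 [simp]: "ssnd l 0 = 0"
  by (simp_all add: sfst_def ssnd_def)

lemma spair_eq_0_iff [simp]: "spair l i j = 0 \<longleftrightarrow> i = 0 \<or> j = 0"
  by (simp add: spair_def)

lemma spair_gt_0_iff [simp]: "0 < spair l i j \<longleftrightarrow> 0 < i \<and> 0 < j"
  by (auto simp: spair_def)

lemma sfst_spair: "\<lbrakk>0 < i; 0 < j; j \<le> l\<rbrakk> \<Longrightarrow> sfst l (spair l i j) = i"
proof -
  assume a: "0 < i" "0 < j" "j \<le> l"
  have "spair l i j - 1 = (j - 1) + (i - 1) * l" using a by (simp add: spair_def)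
  moreover have "(j - 1) div l = 0" using a by simp
  moreover have "((j - 1) + (i - 1) * l) div l = (i - 1) + (j - 1) div l"
    using a by (intro div_mult_self1) simp
  ultimately show ?thesis using a by (simp add: sfst_def)
qed

lemma ssnd_spair: "\<lbrakk>0 < i; 0 < j; j \<le> l\<rbrakk> \<Longrightarrow> ssnd l (spair l i j) = j"
proof -
  assume a: "0 < i" "0 < j" "j \<le> l"
  have "spair l i j - 1 = (j - 1) + (i - 1) * l" using a by (simp add: spair_def)
  moreover have "((j - 1) + (i - 1) * l) mod l = (j - 1) mod l" by (rule mod_mult_self1)
  moreover have "(j - 1) mod l = j - 1" using a by simp
  ultimately show ?thesis using a by (simp add: ssnd_def)
qed

lemma spair_sfst_ssnd [simp]: "spair l (sfst l p) (ssnd l p) = p"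
  by (cases p) (auto simp: spair_def sfst_def ssnd_def)

lemma spair_le: "\<lbrakk>i \<le> k; j \<le> l\<rbrakk> \<Longrightarrow> spair l i j \<le> k * l"
proof (cases "i = 0 \<or> j = 0")
  case False
  assume "i \<le> k" "j \<le> l"
  have "(i - 1) * l + j \<le> (i - 1) * l + l" using \<open>j \<le> l\<close> by simp
  also have "\<dots> = i * l" using False by (cases i) auto
  also have "\<dots> \<le> k * l" using \<open>i \<le> k\<close> by simp
  finally show ?thesis using False by (simp add: spair_def)
qed auto

lemma sfst_le: "p \<le> k * l \<Longrightarrow> sfst l p \<le> k"
proof (cases "p = 0")
  case False
  assume "p \<le> k * l"
  then have "p - 1 < k * l" using False by simp
  then have "(p - 1) div l < k" by (simp add: less_mult_imp_div_less)
  then show ?thesis by (simp add: sfst_def)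
qed simp

lemma ssnd_le: "p \<le> k * l \<Longrightarrow> ssnd l p \<le> l"
  by (cases "l = 0") (auto simp: ssnd_def Suc_le_eq)

lemma sfst_gt: "\<lbrakk>p > k * l; l > 0\<rbrakk> \<Longrightarrow> sfst l p > k"
proof -
  assume a: "p > k * l" "l > 0"
  then have "k * l \<le> p - 1" by simp
  then have "k \<le> (p - 1) div l" using a by (simp add: less_eq_div_iff_mult_less_eq)
  then show ?thesis using a by (simp add: sfst_def)
qed

lemma spair_assoc: "spair m (spair l i j) h = spair (l * m) i (spair m j h)"
proof (cases "i = 0 \<or> j = 0 \<or> h = 0")
  case False
  then obtain a b c where "i = Suc a" "j = Suc b" "h = Suc c"
    by (metis not0_implies_Suc)
  then show ?thesis by (simp add: spair_def algebra_simps)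
qed auto

lemma spair_cases:
  assumes "p \<le> k * l"
  obtains "p = 0" | i j where "p = spair l i j" "0 < i" "i \<le> k" "0 < j" "j \<le> l"
proof (cases "p = 0")
  case False
  then have "0 < sfst l p" "0 < ssnd l p" by (simp_all add: sfst_def ssnd_def)
  then show ?thesis
    using that(2)[of "sfst l p" "ssnd l p"] sfst_le[OF assms] ssnd_le[OF assms] by simp
qed (use that in auto)

subsection \<open>Pointed maps\<close>

lemma gmapsD:
  assumes "f \<in> gmaps m n"
  shows "f 0 = 0" "i \<le> m \<Longrightarrow> f i \<le> n" "i > m \<Longrightarrow> f i = 0"
  using assms by (auto simp: gmaps_def)

lemma gmaps_le: "f \<in> gmaps m n \<Longrightarrow> f i \<le> n"
  by (cases "i \<le> m") (auto simp: gmaps_def)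

lemma gmaps_ext:
  assumes "f \<in> gmaps m n" "g \<in> gmaps m n'" "\<And>i. 0 < i \<Longrightarrow> i \<le> m \<Longrightarrow> f i = g i"
  shows "f = g"
proof
  fix i show "f i = g i"
    using gmapsD[OF assms(1)] gmapsD[OF assms(2)] assms(3)[of i]
    by (cases "i = 0"; cases "i \<le> m") auto
qed

lemma gid_gmaps [simp, intro]: "gid n \<in> gmaps n n"
  by (auto simp: gmaps_def gid_def)

lemma zero_gmaps [simp, intro]: "(\<lambda>_. 0) \<in> gmaps m n"
  by (auto simp: gmaps_def)

lemma gmaps_comp [simp, intro]: "\<lbrakk>f \<in> gmaps m n; g \<in> gmaps n p\<rbrakk> \<Longrightarrow> g \<circ> f \<in> gmaps m p"
  by (auto simp: gmaps_def)

lemma gid_comp [simp]: "f \<in> gmaps m n \<Longrightarrow> gid n \<circ> f = f" "f \<in> gmaps m n \<Longrightarrow> f \<circ> gid m = f"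
  by (auto simp: gid_def fun_eq_iff gmaps_le gmapsD(1,3))

lemma smash_map_gmaps [simp, intro]:
  assumes "f \<in> gmaps k k'" "g \<in> gmaps l l'"
  shows "smash_map l l' f g \<in> gmaps (k * l) (k' * l')"
proof -
  have "smash_map l l' f g p = 0" if "p > k * l" for p
  proof (cases "l = 0")
    case True
    then have "g = (\<lambda>_. 0)"
      using assms(2) by (auto simp: gmaps_def fun_eq_iff) (metis gr0I)
    then show ?thesis by (simp add: smash_map_def)
  next
    case False
    then show ?thesis using sfst_gt[OF that] gmapsD(3)[OF assms(1)] by (simp add: smash_map_def)
  qed
  then show ?thesis
    using assms by (auto simp: gmaps_def smash_map_def intro!: spair_le sfst_le)
      (metis assms gmaps_le spair_le)
qed

lemma smash_map_spair:
  assumes "f \<in> gmaps k k'" "g \<in> gmaps l l'" "j \<le> l"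
  shows "smash_map l l' f g (spair l i j) = spair l' (f i) (g j)"
  using assms gmapsD(1)[OF assms(1)] gmapsD(1)[OF assms(2)]
  by (cases "i = 0 \<or> j = 0") (auto simp: smash_map_def sfst_spair ssnd_spair)

lemma gmaps_ext_pair:
  assumes "f \<in> gmaps (k * l) n" "g \<in> gmaps (k * l) n'"
    "\<And>i j. \<lbrakk>i \<le> k; j \<le> l\<rbrakk> \<Longrightarrow> f (spair l i j) = g (spair l i j)"
  shows "f = g"
  by (rule gmaps_ext[OF assms(1,2)]) (use assms(3) in \<open>auto elim!: spair_cases\<close>)

lemma smash_map_comp:
  assumes "f \<in> gmaps k k'" "g \<in> gmaps l l'" "f' \<in> gmaps k' k''" "g' \<in> gmaps l' l''"
  shows "smash_map l' l'' f' g' \<circ> smash_map l l' f g = smash_map l l'' (f' \<circ> f) (g' \<circ> g)"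
proof (rule gmaps_ext_pair)
  show "smash_map l' l'' f' g' \<circ> smash_map l l' f g \<in> gmaps (k * l) (k'' * l'')"
    using assms by blast
  show "smash_map l l'' (f' \<circ> f) (g' \<circ> g) \<in> gmaps (k * l) (k'' * l'')"
    using assms by blast
  fix i j assume "i \<le> k" "j \<le> l"
  then show "(smash_map l' l'' f' g' \<circ> smash_map l l' f g) (spair l i j)
      = smash_map l l'' (f' \<circ> f) (g' \<circ> g) (spair l i j)"
    using assms gmapsD(2)[OF assms(2)]
    by (simp add: smash_map_spair[OF assms(1,2)] smash_map_spair[OF assms(3,4)]
        smash_map_spair[OF gmaps_comp[OF assms(1,3)] gmaps_comp[OF assms(2,4)]])
qed

lemma smash_map_gid [simp]: "smash_map l l (gid k) (gid l) = gid (k * l)"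
proof (rule gmaps_ext_pair)
  fix i j assume "i \<le> k" "j \<le> l"
  then show "smash_map l l (gid k) (gid l) (spair l i j) = gid (k * l) (spair l i j)"
    by (simp add: smash_map_spair[OF gid_gmaps gid_gmaps]) (simp add: gid_def spair_le)
qed auto

lemma interchange_spair:
  assumes "a \<le> k" "a' \<le> k'" "b \<le> l" "b' \<le> l'"
  shows "interchange k k' l l' (spair (l * l') (spair k' a a') (spair l' b b'))
    = spair (k' * l') (spair l a b) (spair l' a' b')"
proof (cases "a = 0 \<or> a' = 0 \<or> b = 0 \<or> b' = 0")
  case True
  then show ?thesis by (auto simp: interchange_def)
next
  case False
  have "spair l' b b' \<le> l * l'" using assms by (simp add: spair_le)
  moreover have "spair (l * l') (spair k' a a') (spair l' b b') \<le> k * k' * (l * l')"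
    using assms by (simp add: spair_le)
  ultimately show ?thesis
    using False assms by (simp add: interchange_def sfst_spair ssnd_spair Let_def)
qed

lemma interchange_gmaps [simp, intro]:
  "interchange k k' l l' \<in> gmaps (k * k' * (l * l')) (k * l * (k' * l'))"
  by (auto simp: gmaps_def interchange_def Let_def intro!: spair_le sfst_le ssnd_le)

lemma gmaps_ext_quad:
  assumes "f \<in> gmaps (k * k' * (l * l')) n" "g \<in> gmaps (k * k' * (l * l')) n'"
    "\<And>a a' b b'. \<lbrakk>a \<le> k; a' \<le> k'; b \<le> l; b' \<le> l'\<rbrakk>
      \<Longrightarrow> f (spair (l * l') (spair k' a a') (spair l' b b'))
        = g (spair (l * l') (spair k' a a') (spair l' b b'))"
  shows "f = g"
proof (rule gmaps_ext_pair[OF assms(1,2)])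
  fix i j assume "i \<le> k * k'" "j \<le> l * l'"
  moreover have "sfst k' i \<le> k" "ssnd k' i \<le> k'" "sfst l' j \<le> l" "ssnd l' j \<le> l'"
    using calculation by (auto intro: sfst_le ssnd_le)
  ultimately show "f (spair (l * l') i j) = g (spair (l * l') i j)"
    using assms(3)[of "sfst k' i" "ssnd k' i" "sfst l' j" "ssnd l' j"] by simp
qed

lemma sleft_gmaps [simp, intro]: "i \<le> m \<Longrightarrow> sleft n i \<in> gmaps n (m * n)"
  by (auto simp: gmaps_def sleft_def spair_le)

lemma sright_gmaps [simp, intro]: "j \<le> n \<Longrightarrow> sright m n j \<in> gmaps m (m * n)"
  by (auto simp: gmaps_def sright_def spair_le)


subsection \<open>The Day convolution is a \<open>\<Gamma>\<close>-set with the expected universal property\<close>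

lemma gamma_setD:
  assumes "is_gamma_set F"
  shows "bpt F n \<in> obj F n"
    "\<lbrakk>f \<in> gmaps m n; x \<in> obj F m\<rbrakk> \<Longrightarrow> arr F m n f x \<in> obj F n"
    "f \<in> gmaps m n \<Longrightarrow> arr F m n f (bpt F m) = bpt F n"
    "x \<in> obj F n \<Longrightarrow> arr F n n (gid n) x = x"
    "\<lbrakk>f \<in> gmaps m n; g \<in> gmaps n p; x \<in> obj F m\<rbrakk>
       \<Longrightarrow> arr F m p (g \<circ> f) x = arr F n p g (arr F m n f x)"
    "obj F 0 = {bpt F 0}"
  using assms unfolding is_gamma_set_def by blast+

lemma gamma_homD:
  assumes "gamma_hom F G h"
  shows "x \<in> obj F n \<Longrightarrow> h n x \<in> obj G n" "h n (bpt F n) = bpt G n"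
    "\<lbrakk>f \<in> gmaps m n; x \<in> obj F m\<rbrakk> \<Longrightarrow> h n (arr F m n f x) = arr G m n f (h m x)"
  using assms unfolding gamma_hom_def by blast+

lemma bimorphismD:
  assumes "bimorphism F G H b"
  shows "\<lbrakk>x \<in> obj F k; y \<in> obj G l\<rbrakk> \<Longrightarrow> b k l x y \<in> obj H (k * l)"
    "y \<in> obj G l \<Longrightarrow> b k l (bpt F k) y = bpt H (k * l)"
    "x \<in> obj F k \<Longrightarrow> b k l x (bpt G l) = bpt H (k * l)"
    "\<lbrakk>f \<in> gmaps k k'; g \<in> gmaps l l'; x \<in> obj F k; y \<in> obj G l\<rbrakk> \<Longrightarrow>
        b k' l' (arr F k k' f x) (arr G l l' g y) =
        arr H (k * l) (k' * l') (smash_map l l' f g) (b k l x y)"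
  using assms unfolding bimorphism_def by blast+

locale two_gamma_sets =
  fixes F :: "('a, 'x) gamma_set_scheme" and G :: "('b, 'y) gamma_set_scheme"
  assumes F: "is_gamma_set F" and G: "is_gamma_set G"
begin

lemma day_eq_elts: "day_eq F G n s t \<Longrightarrow> s \<in> day_elts F G n \<and> t \<in> day_elts F G n"
  by (induction rule: day_eq.induct)
    (auto simp: day_axes_def day_elts_def gamma_setD(2)[OF F] gamma_setD(2)[OF G]
      intro!: gmaps_comp)

lemma equiv_day_rel: "equiv (day_elts F G n) (day_rel F G n)"
proof (rule equivI)
  show "day_rel F G n \<subseteq> day_elts F G n \<times> day_elts F G n"
    using day_eq_elts by (auto simp: day_rel_def)
  show "refl_on (day_elts F G n) (day_rel F G n)"
    by (auto simp: refl_on_def day_rel_def intro: day_eq.refl)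
  show "sym (day_rel F G n)"
    by (auto simp: sym_def day_rel_def intro: day_eq.sym)
  show "trans (day_rel F G n)"
    by (auto simp: trans_def day_rel_def intro: day_eq.trans)
qed

lemma day_class_eqI: "day_eq F G n s t \<Longrightarrow> day_class F G n s = day_class F G n t"
  unfolding day_class_def by (rule equiv_class_eq[OF equiv_day_rel]) (simp add: day_rel_def)

lemma day_class_mem: "t \<in> day_elts F G n \<Longrightarrow> day_class F G n t \<in> obj (day F G) n"
  by (simp add: day_def day_class_def quotientI)

lemma day_obj_cases:
  assumes "c \<in> obj (day F G) n"
  obtains k l v x y where "c = day_class F G n (k, l, v, x, y)"
    "v \<in> gmaps (k * l) n" "x \<in> obj F k" "y \<in> obj G l"
  using assms by (auto simp: day_def day_class_def day_elts_def elim!: quotientE)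

lemma day_class_axes: "t \<in> day_axes F G n \<Longrightarrow> day_class F G n t = bpt (day F G) n"
  unfolding day_def gamma_set.simps
  by (rule day_class_eqI, rule day_eq.base)
    (auto simp: day_axes_def day_elts_def gamma_setD(1)[OF F] gamma_setD(1)[OF G])

lemma day_bpt_cases:
  obtains t where "t \<in> day_axes F G n" "bpt (day F G) n = day_class F G n t"
  using that[of "(0, 0, (\<lambda>_. 0), bpt F 0, bpt G 0)"]
  by (auto simp: day_def day_axes_def day_elts_def gamma_setD(1)[OF F] gamma_setD(1)[OF G])

lemma day_push_eq:
  assumes "day_eq F G m s t" "f \<in> gmaps m n"
  shows "day_eq F G n (day_push f s) (day_push f t)"
  using assms
proof (induction rule: day_eq.induct)
  case (transition g k k' h l l' v x y)
  have "day_eq F G n (k, l, (f \<circ> v) \<circ> smash_map l l' g h, x, y)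
      (k', l', f \<circ> v, arr F k k' g x, arr G l l' h y)"
    using transition by (intro day_eq.transition) auto
  then show ?case by (simp add: comp_assoc)
next
  case (base s t)
  then show ?case
    by (intro day_eq.base) (auto simp: day_axes_def day_elts_def)
next
  case (refl t)
  then show ?case by (intro day_eq.refl) (auto simp: day_elts_def)
qed (auto intro: day_eq.sym day_eq.trans)

lemma day_arr_class:
  assumes "f \<in> gmaps m n" "t \<in> day_elts F G m"
  shows "arr (day F G) m n f (day_class F G m t) = day_class F G n (day_push f t)"
proof -
  have "(\<lambda>t. day_class F G n (day_push f t)) respects day_rel F G m"
    by (rule congruentI) (simp add: day_rel_def day_class_eqI day_push_eq[OF _ assms(1)])
  from UN_equiv_class[OF equiv_day_rel this assms(2)]
  show ?thesis by (simp add: day_def day_class_def)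
qed

lemma day_arr_class':
  assumes "f \<in> gmaps m n" "v \<in> gmaps (k * l) m" "x \<in> obj F k" "y \<in> obj G l"
  shows "arr (day F G) m n f (day_class F G m (k, l, v, x, y)) = day_class F G n (k, l, f \<circ> v, x, y)"
  using day_arr_class[OF assms(1), of "(k, l, v, x, y)"] assms by (simp add: day_elts_def)

theorem is_gamma_set_day: "is_gamma_set (day F G)"
  unfolding is_gamma_set_def
proof (intro conjI allI ballI)
  fix m n p f g c
  show bp: "bpt (day F G) n \<in> obj (day F G) n"
    by (auto simp: day_axes_def intro!: day_class_mem intro: day_bpt_cases[of n])
  show "arr (day F G) m n f (bpt (day F G) m) = bpt (day F G) n" if "f \<in> gmaps m n"
  proof -
    obtain t where t: "t \<in> day_axes F G m" "bpt (day F G) m = day_class F G m t"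
      by (rule day_bpt_cases)
    have "t \<in> day_elts F G m" "day_push f t \<in> day_axes F G n"
      using t that by (auto simp: day_axes_def day_elts_def)
    then show ?thesis using that t(2) by (simp add: day_arr_class day_class_axes)
  qed
  show "arr (day F G) m n f c \<in> obj (day F G) n" if "f \<in> gmaps m n" "c \<in> obj (day F G) m"
    using that(2) by (rule day_obj_cases)
      (use that in \<open>auto simp: day_arr_class' day_elts_def intro!: day_class_mem\<close>)
  show "arr (day F G) n n (gid n) c = c" if "c \<in> obj (day F G) n"
    using that by (rule day_obj_cases) (use that in \<open>auto simp: day_arr_class'\<close>)
  show "arr (day F G) m p (g \<circ> f) c = arr (day F G) n p g (arr (day F G) m n f c)"
    if "f \<in> gmaps m n" "g \<in> gmaps n p" "c \<in> obj (day F G) m"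
    using that(3) by (rule day_obj_cases)
      (use that in \<open>auto simp: day_arr_class'[OF that(1)] day_arr_class'[OF that(2)]
        day_arr_class'[OF gmaps_comp[OF that(1,2)]] comp_assoc\<close>)
next
  have "c = bpt (day F G) 0" if c: "c \<in> obj (day F G) 0" for c
  proof -
    obtain k l v x y where e: "c = day_class F G 0 (k, l, v, x, y)"
      "v \<in> gmaps (k * l) 0" "x \<in> obj F k" "y \<in> obj G l" using c by (rule day_obj_cases)
    have "v = (\<lambda>_. 0) \<circ> smash_map l 0 (\<lambda>_. 0) (\<lambda>_. 0)"
      using gmaps_le[OF e(2)] by auto
    then have "day_eq F G 0 (k, l, v, x, y) (0, 0, \<lambda>_. 0, arr F k 0 (\<lambda>_. 0) x, arr G l 0 (\<lambda>_. 0) y)"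
      using e by (auto intro!: day_eq.transition)
    moreover have "arr F k 0 (\<lambda>_. 0) x = bpt F 0"
      using gamma_setD(2)[OF F zero_gmaps e(3), of 0] gamma_setD(6)[OF F] by simp
    moreover have "arr G l 0 (\<lambda>_. 0) y = bpt G 0"
      using gamma_setD(2)[OF G zero_gmaps e(4), of 0] gamma_setD(6)[OF G] by simp
    ultimately show ?thesis using e(1) by (simp add: day_class_eqI) (simp add: day_def)
  qed
  moreover have "bpt (day F G) 0 \<in> obj (day F G) 0"
    by (auto simp: day_axes_def intro!: day_class_mem intro: day_bpt_cases[of 0])
  ultimately show "obj (day F G) 0 = {bpt (day F G) 0}" by blast
qed

definition day_in :: "nat \<Rightarrow> nat \<Rightarrow> 'a \<Rightarrow> 'b \<Rightarrow> ('a, 'b) day_elt set" where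
  "day_in k l x y = day_class F G (k * l) (k, l, gid (k * l), x, y)"

lemma day_class_conv_in:
  assumes "v \<in> gmaps (k * l) n" "x \<in> obj F k" "y \<in> obj G l"
  shows "day_class F G n (k, l, v, x, y) = arr (day F G) (k * l) n v (day_in k l x y)"
  using assms by (simp add: day_in_def day_arr_class')

theorem bimorphism_day_in: "bimorphism F G (day F G) day_in"
  unfolding bimorphism_def
proof (intro conjI allI ballI)
  fix k l k' l' f g x y
  show "day_in k l x y \<in> obj (day F G) (k * l)" if "x \<in> obj F k" "y \<in> obj G l"
    using that unfolding day_in_def by (intro day_class_mem) (auto simp: day_elts_def)
  show "day_in k l (bpt F k) y = bpt (day F G) (k * l)" if "y \<in> obj G l"
    using that unfolding day_in_def
    by (intro day_class_axes) (auto simp: day_axes_def day_elts_def gamma_setD(1)[OF F])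
  show "day_in k l x (bpt G l) = bpt (day F G) (k * l)" if "x \<in> obj F k"
    using that unfolding day_in_def
    by (intro day_class_axes) (auto simp: day_axes_def day_elts_def gamma_setD(1)[OF G])
  assume a: "f \<in> gmaps k k'" "g \<in> gmaps l l'" "x \<in> obj F k" "y \<in> obj G l"
  have "day_eq F G (k' * l') (k, l, gid (k' * l') \<circ> smash_map l l' f g, x, y)
      (k', l', gid (k' * l'), arr F k k' f x, arr G l l' g y)"
    using a by (intro day_eq.transition) auto
  then show "day_in k' l' (arr F k k' f x) (arr G l l' g y) =
      arr (day F G) (k * l) (k' * l') (smash_map l l' f g) (day_in k l x y)"
    unfolding day_in_def using a
    by (subst day_arr_class') (auto simp: gid_comp[OF smash_map_gmaps] intro!: day_class_eqI[symmetric])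
qed

end

theorem bimorphism_of_hom:
  assumes F: "is_gamma_set F" and G: "is_gamma_set G" and h: "gamma_hom (day F G) H h"
  shows "bimorphism F G H (\<lambda>k l x y. h (k * l) (two_gamma_sets.day_in F G k l x y))"
proof -
  interpret two_gamma_sets F G using F G by unfold_locales
  show ?thesis
    using bimorphismD[OF bimorphism_day_in] gamma_homD[OF h] unfolding bimorphism_def
    by (auto intro!: gamma_homD(3)[OF h] simp: gamma_homD(2)[OF h])
qed

theorem day_factors:
  assumes F: "is_gamma_set F" and G: "is_gamma_set G" and H: "is_gamma_set H"
    and b: "bimorphism F G H b"
  shows "\<exists>h. gamma_hom (day F G) H h \<and>
    (\<forall>k l. \<forall>x\<in>obj F k. \<forall>y\<in>obj G l. h (k * l) (two_gamma_sets.day_in F G k l x y) = b k l x y)"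
proof -
  interpret two_gamma_sets F G using F G by unfold_locales
  define e where "e n t = (case t of (k, l, v, x, y) \<Rightarrow> arr H (k * l) n v (b k l x y))"
    for n and t :: "('a, 'c) day_elt"
  have ax: "e n t = bpt H n" if "t \<in> day_axes F G n" for n t
    using that bimorphismD[OF b] gamma_setD[OF H] by (auto simp: day_axes_def day_elts_def e_def)
  have e_eq: "e n s = e n t" if "day_eq F G n s t" for n s t
    using that
  proof (induction rule: day_eq.induct)
    case (transition f k k' g l l' v x y)
    then show ?case
      by (simp add: e_def bimorphismD(4)[OF b] bimorphismD(1)[OF b]
          gamma_setD(5)[OF H smash_map_gmaps])
  qed (simp_all add: ax)
  define h where "h n c = e n (SOME t. t \<in> c)" for n c
  have h_class: "h n (day_class F G n t) = e n t" if "t \<in> day_elts F G n" for n t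
  proof -
    have "t \<in> day_class F G n t"
      using that by (simp add: day_class_def day_rel_def day_eq.refl)
    then have "(SOME s. s \<in> day_class F G n t) \<in> day_class F G n t" by (rule someI)
    then have "day_eq F G n t (SOME s. s \<in> day_class F G n t)"
      by (simp add: day_class_def day_rel_def)
    then show ?thesis unfolding h_def by (metis e_eq)
  qed
  have "gamma_hom (day F G) H h"
    unfolding gamma_hom_def
  proof (intro conjI allI ballI)
    fix n c assume "c \<in> obj (day F G) n"
    then show "h n c \<in> obj H n"
      by (rule day_obj_cases)
        (auto simp: h_class day_elts_def e_def intro!: gamma_setD(2)[OF H] bimorphismD(1)[OF b])
  next
    fix n
    obtain t where t: "t \<in> day_axes F G n" "bpt (day F G) n = day_class F G n t"
      by (rule day_bpt_cases)
    then show "h n (bpt (day F G) n) = bpt H n"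
      using ax[OF t(1)] by (simp add: h_class day_axes_def split: prod.splits)
  next
    fix m n f c assume a: "f \<in> gmaps m n" "c \<in> obj (day F G) m"
    from a(2) show "h n (arr (day F G) m n f c) = arr H m n f (h m c)"
    proof (rule day_obj_cases)
      fix k l v x y
      assume "c = day_class F G m (k, l, v, x, y)" and
        v: "v \<in> gmaps (k * l) m" "x \<in> obj F k" "y \<in> obj G l"
      then show ?thesis using a(1)
        by (simp add: day_arr_class'[OF a(1)] h_class day_elts_def e_def
            gamma_setD(5)[OF H v(1) a(1)] bimorphismD(1)[OF b])
    qed
  qed
  moreover have "h (k * l) (day_in k l x y) = b k l x y" if "x \<in> obj F k" "y \<in> obj G l" for k l x y
    using that by (simp add: day_in_def h_class day_elts_def e_def gamma_setD(4)[OF H] bimorphismD(1)[OF b])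
  ultimately show ?thesis by blast
qed

theorem day_factors_unique:
  assumes F: "is_gamma_set F" and G: "is_gamma_set G"
    and h: "gamma_hom (day F G) H h" "gamma_hom (day F G) H h'"
    and eq: "\<And>k l x y. \<lbrakk>x \<in> obj F k; y \<in> obj G l\<rbrakk> \<Longrightarrow>
      h (k * l) (two_gamma_sets.day_in F G k l x y) = h' (k * l) (two_gamma_sets.day_in F G k l x y)"
    and c: "c \<in> obj (day F G) n"
  shows "h n c = h' n c"
proof -
  interpret two_gamma_sets F G using F G by unfold_locales
  obtain k l v x y where "c = day_class F G n (k, l, v, x, y)" and
    v: "v \<in> gmaps (k * l) n" "x \<in> obj F k" "y \<in> obj G l"
    using c by (rule day_obj_cases)
  then show ?thesis
    using bimorphismD(1)[OF bimorphism_day_in v(2,3)]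
    by (simp add: day_class_conv_in gamma_homD(3)[OF h(1)] gamma_homD(3)[OF h(2)] eq)
qed


subsection \<open>The smash product of \<open>\<S>\<close>-algebras is an \<open>\<S>\<close>-algebra\<close>

lemma s_algebraD:
  assumes "is_s_algebra A"
  shows "is_gamma_set A" "bimorphism A A A (mul A)" "gamma_hom sphere A (one A)"
    "\<lbrakk>x \<in> obj A k; y \<in> obj A l; z \<in> obj A m\<rbrakk>
       \<Longrightarrow> mul A (k * l) m (mul A k l x y) z = mul A k (l * m) x (mul A l m y z)"
    "\<lbrakk>i \<le> m; x \<in> obj A n\<rbrakk> \<Longrightarrow> mul A m n (one A m i) x = arr A n (m * n) (sleft n i) x"
    "\<lbrakk>j \<le> n; x \<in> obj A m\<rbrakk> \<Longrightarrow> mul A m n x (one A n j) = arr A m (m * n) (sright m n j) x"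
    "i \<le> n \<Longrightarrow> one A n i \<in> obj A n"
    "\<lbrakk>i \<le> m; f \<in> gmaps m n\<rbrakk> \<Longrightarrow> one A n (f i) = arr A m n f (one A m i)"
    "one A n 0 = bpt A n"
  using assms unfolding is_s_algebra_def gamma_hom_def sphere_def by auto

locale two_s_algebras =
  fixes A :: "('a, 'x) s_algebra_scheme" and B :: "('b, 'y) s_algebra_scheme"
  assumes A: "is_s_algebra A" and B: "is_s_algebra B"
begin

sublocale two_gamma_sets A B
  using s_algebraD(1)[OF A] s_algebraD(1)[OF B] by unfold_locales

definition cross :: "nat \<Rightarrow> nat \<Rightarrow> nat \<Rightarrow> nat \<Rightarrow> nat \<Rightarrow> (nat \<Rightarrow> nat) \<Rightarrow> (nat \<Rightarrow> nat) \<Rightarrow> nat \<Rightarrow> nat" where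
  "cross n k l k' l' v w = smash_map (k' * l') n v w \<circ> interchange k k' l l'"

lemma cross_gmaps [simp, intro]:
  "\<lbrakk>v \<in> gmaps (k * l) m; w \<in> gmaps (k' * l') n\<rbrakk>
    \<Longrightarrow> cross n k l k' l' v w \<in> gmaps (k * k' * (l * l')) (m * n)"
  unfolding cross_def by blast

lemma cross_spair:
  assumes "v \<in> gmaps (k * l) m" "w \<in> gmaps (k' * l') n" "a \<le> k" "a' \<le> k'" "b \<le> l" "b' \<le> l'"
  shows "cross n k l k' l' v w (spair (l * l') (spair k' a a') (spair l' b b'))
    = spair n (v (spair l a b)) (w (spair l' a' b'))"
  using assms by (simp add: cross_def interchange_spair smash_map_spair[OF assms(1,2)] spair_le)

lemma cross_transition:
  assumes f: "f \<in> gmaps k1 k2" "g \<in> gmaps l1 l2" "v \<in> gmaps (k2 * l2) m"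
    and f': "f' \<in> gmaps k1' k2'" "g' \<in> gmaps l1' l2'" "w \<in> gmaps (k2' * l2') n"
  shows "cross n k1 l1 k1' l1' (v \<circ> smash_map l1 l2 f g) (w \<circ> smash_map l1' l2' f' g') =
    cross n k2 l2 k2' l2' v w \<circ>
      smash_map (l1 * l1') (l2 * l2') (smash_map k1' k2' f f') (smash_map l1' l2' g g')"
    (is "?L = ?R")
proof (rule gmaps_ext_quad)
  have vs: "v \<circ> smash_map l1 l2 f g \<in> gmaps (k1 * l1) m"
      "w \<circ> smash_map l1' l2' f' g' \<in> gmaps (k1' * l1') n"
    using assms by blast+
  show "?L \<in> gmaps (k1 * k1' * (l1 * l1')) (m * n)" using vs by (rule cross_gmaps)
  show "?R \<in> gmaps (k1 * k1' * (l1 * l1')) (m * n)"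
    using assms by (intro gmaps_comp[of _ _ "k2 * k2' * (l2 * l2')"]) auto
  fix a a' b b' assume i: "a \<le> k1" "a' \<le> k1'" "b \<le> l1" "b' \<le> l1'"
  show "?L (spair (l1 * l1') (spair k1' a a') (spair l1' b b'))
      = ?R (spair (l1 * l1') (spair k1' a a') (spair l1' b b'))"
    using i assms
    by (simp add: cross_spair[OF vs] smash_map_spair[OF f(1,2)] smash_map_spair[OF f'(1,2)]
        smash_map_spair[OF smash_map_gmaps[OF f(1) f'(1)] smash_map_gmaps[OF f(2) f'(2)]]
        smash_map_spair[OF f(1) f'(1)] smash_map_spair[OF f(2) f'(2)]
        spair_le cross_spair[OF f(3) f'(3)] gmaps_le)
qed

lemma cross_comp:
  assumes "v \<in> gmaps (k * l) m" "w \<in> gmaps (k' * l') n" "f \<in> gmaps m m'" "g \<in> gmaps n n'"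
  shows "smash_map n n' f g \<circ> cross n k l k' l' v w = cross n' k l k' l' (f \<circ> v) (g \<circ> w)"
  using assms
  by (simp add: cross_def comp_assoc[symmetric] smash_map_comp[OF assms(1,2,3,4)])

lemma mul_elt: "day_mul_elt A B n (k, l, v, x, y) (k', l', w, x', y') =
    (k * k', l * l', cross n k l k' l' v w, mul A k k' x x', mul B l l' y y')"
  by (simp add: cross_def)

declare day_mul_elt.simps [simp del] mul_elt [simp]

lemma mul_axes:
  assumes "s \<in> day_elts A B m" "t \<in> day_elts A B n" "s \<in> day_axes A B m \<or> t \<in> day_axes A B n"
  shows "day_mul_elt A B n s t \<in> day_axes A B (m * n)"
  using assms gamma_setD(1)[OF F] gamma_setD(1)[OF G]
  by (cases s; cases t)
    (auto simp: day_axes_def day_elts_def bimorphismD(1-3)[OF s_algebraD(2)[OF A]]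
      bimorphismD(1-3)[OF s_algebraD(2)[OF B]])

lemma mul_elts:
  assumes "s \<in> day_elts A B m" "t \<in> day_elts A B n"
  shows "day_mul_elt A B n s t \<in> day_elts A B (m * n)"
  using assms
  by (cases s; cases t)
    (auto simp: day_elts_def bimorphismD(1)[OF s_algebraD(2)[OF A]]
      bimorphismD(1)[OF s_algebraD(2)[OF B]])

lemma mul_eq_left:
  assumes "day_eq A B m s s'" "t \<in> day_elts A B n"
  shows "day_eq A B (m * n) (day_mul_elt A B n s t) (day_mul_elt A B n s' t)"
  using assms
proof (induction rule: day_eq.induct)
  case (transition f k k' g l l' v x y)
  obtain k'' l'' w x' y' where t: "t = (k'', l'', w, x', y')" "w \<in> gmaps (k'' * l'') n"
    "x' \<in> obj A k''" "y' \<in> obj B l''"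
    using transition by (auto simp: day_elts_def)
  have "w = w \<circ> smash_map l'' l'' (gid k'') (gid l'')" using t by simp
  then have c: "cross n k l k'' l'' (v \<circ> smash_map l l' f g) w =
      cross n k' l' k'' l'' v w \<circ>
        smash_map (l * l'') (l' * l'') (smash_map k'' k'' f (gid k'')) (smash_map l'' l'' g (gid l''))"
    using cross_transition[OF transition(1-3) gid_gmaps gid_gmaps t(2)] by simp
  have xs: "mul A k' k'' (arr A k k' f x) x' =
      arr A (k * k'') (k' * k'') (smash_map k'' k'' f (gid k'')) (mul A k k'' x x')"
    using bimorphismD(4)[OF s_algebraD(2)[OF A] transition(1) gid_gmaps transition(4) t(3)]
      gamma_setD(4)[OF F t(3)] by simp
  have ys: "mul B l' l'' (arr B l l' g y) y' =
      arr B (l * l'') (l' * l'') (smash_map l'' l'' g (gid l'')) (mul B l l'' y y')"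
    using bimorphismD(4)[OF s_algebraD(2)[OF B] transition(2) gid_gmaps transition(5) t(4)]
      gamma_setD(4)[OF G t(4)] by simp
  show ?case
    unfolding t mul_elt c xs ys
    using transition t bimorphismD(1)[OF s_algebraD(2)[OF A]] bimorphismD(1)[OF s_algebraD(2)[OF B]]
    by (intro day_eq.transition) auto
next
  case (base s s')
  then show ?case by (intro day_eq.base mul_axes) (auto simp: day_axes_def)
next
  case (refl s)
  then show ?case by (intro day_eq.refl mul_elts)
qed (auto intro: day_eq.sym day_eq.trans)

lemma mul_eq_right:
  assumes "day_eq A B n t t'" "s \<in> day_elts A B m"
  shows "day_eq A B (m * n) (day_mul_elt A B n s t) (day_mul_elt A B n s t')"
  using assms
proof (induction rule: day_eq.induct)
  case (transition f k k' g l l' v x y)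
  obtain k'' l'' w x' y' where s: "s = (k'', l'', w, x', y')" "w \<in> gmaps (k'' * l'') m"
    "x' \<in> obj A k''" "y' \<in> obj B l''"
    using transition by (auto simp: day_elts_def)
  have "w = w \<circ> smash_map l'' l'' (gid k'') (gid l'')" using s by simp
  then have c: "cross n k'' l'' k l w (v \<circ> smash_map l l' f g) =
      cross n k'' l'' k' l' w v \<circ>
        smash_map (l'' * l) (l'' * l') (smash_map k k' (gid k'') f) (smash_map l l' (gid l'') g)"
    using cross_transition[OF gid_gmaps gid_gmaps s(2) transition(1-3)] by simp
  have xs: "mul A k'' k' x' (arr A k k' f x) =
      arr A (k'' * k) (k'' * k') (smash_map k k' (gid k'') f) (mul A k'' k x' x)"
    using bimorphismD(4)[OF s_algebraD(2)[OF A] gid_gmaps transition(1) s(3) transition(4)]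
      gamma_setD(4)[OF F s(3)] by simp
  have ys: "mul B l'' l' y' (arr B l l' g y) =
      arr B (l'' * l) (l'' * l') (smash_map l l' (gid l'') g) (mul B l'' l y' y)"
    using bimorphismD(4)[OF s_algebraD(2)[OF B] gid_gmaps transition(2) s(4) transition(5)]
      gamma_setD(4)[OF G s(4)] by simp
  show ?case
    unfolding s mul_elt c xs ys
    using transition s bimorphismD(1)[OF s_algebraD(2)[OF A]] bimorphismD(1)[OF s_algebraD(2)[OF B]]
    by (intro day_eq.transition) auto
next
  case (base t t')
  then show ?case by (intro day_eq.base mul_axes) (auto simp: day_axes_def)
next
  case (refl t)
  then show ?case by (intro day_eq.refl mul_elts)
qed (auto intro: day_eq.sym day_eq.trans)

lemma day_mul_class:
  assumes "s \<in> day_elts A B m" "t \<in> day_elts A B n"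
  shows "mul (s_smash A B) m n (day_class A B m s) (day_class A B n t)
    = day_class A B (m * n) (day_mul_elt A B n s t)"
proof -
  have "congruent2 (day_rel A B m) (day_rel A B n)
      (\<lambda>s t. day_class A B (m * n) (day_mul_elt A B n s t))"
  proof (rule congruent2I')
    fix s s' t t' assume a: "(s, s') \<in> day_rel A B m" "(t, t') \<in> day_rel A B n"
    then have "day_eq A B (m * n) (day_mul_elt A B n s t) (day_mul_elt A B n s' t)"
      by (intro mul_eq_left) (auto simp: day_rel_def dest: day_eq_elts)
    moreover have "day_eq A B (m * n) (day_mul_elt A B n s' t) (day_mul_elt A B n s' t')"
      using a by (intro mul_eq_right) (auto simp: day_rel_def dest: day_eq_elts)
    ultimately show "day_class A B (m * n) (day_mul_elt A B n s t) =
        day_class A B (m * n) (day_mul_elt A B n s' t')"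
      by (intro day_class_eqI) (rule day_eq.trans)
  qed
  from UN_equiv_class2[OF equiv_day_rel equiv_day_rel this assms]
  show ?thesis by (simp add: day_class_def)
qed

lemma day_mul_class':
  assumes "v \<in> gmaps (k * l) m" "x \<in> obj A k" "y \<in> obj B l"
    "w \<in> gmaps (k' * l') n" "x' \<in> obj A k'" "y' \<in> obj B l'"
  shows "mul (s_smash A B) m n (day_class A B m (k, l, v, x, y)) (day_class A B n (k', l', w, x', y'))
    = day_class A B (m * n)
       (k * k', l * l', cross n k l k' l' v w, mul A k k' x x', mul B l l' y y')"
  using assms day_mul_class[of "(k, l, v, x, y)" m "(k', l', w, x', y')" n]
  by (simp add: day_elts_def)

lemma cross_assoc:
  assumes u: "u \<in> gmaps (k * l) m" "v \<in> gmaps (k' * l') n" "w \<in> gmaps (k'' * l'') p"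
  shows "cross p (k * k') (l * l') k'' l'' (cross n k l k' l' u v) w =
    cross (n * p) k l (k' * k'') (l' * l'') u (cross p k' l' k'' l'' v w)" (is "?L = ?R")
proof (rule gmaps_ext_quad)
  show "?L \<in> gmaps (k * k' * k'' * (l * l' * l'')) (m * n * p)" using u by (intro cross_gmaps)
  show "?R \<in> gmaps (k * k' * k'' * (l * l' * l'')) (m * (n * p))"
    using cross_gmaps[OF u(1) cross_gmaps[OF u(2,3)]] by (simp add: mult.assoc)
  fix q c r d assume i: "q \<le> k * k'" "c \<le> k''" "r \<le> l * l'" "d \<le> l''"
  define a a' b b' where "a = sfst k' q" "a' = ssnd k' q" "b = sfst l' r" "b' = ssnd l' r"
  have qr: "q = spair k' a a'" "r = spair l' b b'" by (simp_all add: a_a'_b_b'_def)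
  have le: "a \<le> k" "a' \<le> k'" "b \<le> l" "b' \<le> l'"
    using i by (auto simp: a_a'_b_b'_def intro: sfst_le ssnd_le)
  have "?L (spair (l * l' * l'') (spair k'' q c) (spair l'' r d)) =
      spair p (spair n (u (spair l a b)) (v (spair l' a' b'))) (w (spair l'' c d))"
    using i le by (subst cross_spair[OF cross_gmaps[OF u(1,2)] u(3)])
      (auto simp: qr cross_spair[OF u(1,2)])
  also have "\<dots> = spair (n * p) (u (spair l a b)) (spair p (v (spair l' a' b')) (w (spair l'' c d)))"
    by (rule spair_assoc)
  also have "\<dots> = ?R (spair (l * (l' * l'')) (spair (k' * k'') a (spair k'' a' c))
      (spair (l' * l'') b (spair l'' b' d)))"
    using i le by (subst cross_spair[OF u(1) cross_gmaps[OF u(2,3)]])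
      (auto simp: cross_spair[OF u(2,3)] spair_le)
  finally show "?L (spair (l * l' * l'') (spair k'' q c) (spair l'' r d)) =
      ?R (spair (l * l' * l'') (spair k'' q c) (spair l'' r d))"
    by (simp add: qr spair_assoc mult.assoc)
qed

lemma one_smash_cases:
  assumes "i \<le> m"
  shows "one (s_smash A B) m i = day_class A B m (m, 1, gid m, one A m i, one B 1 1)"
  by simp

lemma one_smash_elt: "i \<le> m \<Longrightarrow> (m, 1, gid m, one A m i, one B 1 1) \<in> day_elts A B m"
  by (auto simp: day_elts_def s_algebraD(7)[OF A] s_algebraD(7)[OF B])

theorem is_s_algebra_smash: "is_s_algebra (s_smash A B)"
proof -
  let ?S = "s_smash A B"
  have g: "is_gamma_set ?S"
    using is_gamma_set_day by (simp add: is_gamma_set_def)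
  have bim: "bimorphism ?S ?S ?S (mul ?S)"
    unfolding bimorphism_def
  proof (intro conjI allI ballI)
    fix m n c d assume cd: "c \<in> obj ?S m" "d \<in> obj ?S n"
    obtain k l v x y where c: "c = day_class A B m (k, l, v, x, y)"
      "v \<in> gmaps (k * l) m" "x \<in> obj A k" "y \<in> obj B l"
      using cd by (auto elim: day_obj_cases)
    obtain k' l' w x' y' where d: "d = day_class A B n (k', l', w, x', y')"
      "w \<in> gmaps (k' * l') n" "x' \<in> obj A k'" "y' \<in> obj B l'"
      using cd by (auto elim: day_obj_cases)
    note mem = bimorphismD(1)[OF s_algebraD(2)[OF A] c(3) d(3)]
      bimorphismD(1)[OF s_algebraD(2)[OF B] c(4) d(4)]
    show "mul ?S m n c d \<in> obj ?S (m * n)"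
      unfolding c(1) d(1) day_mul_class'[OF c(2-4) d(2-4)] using c d mem
      by (auto simp: day_elts_def simp del: s_smash_simps(4) intro!: day_class_mem)
    fix m' n' f h assume fh: "f \<in> gmaps m m'" "h \<in> gmaps n n'"
    have "mul ?S m' n' (arr ?S m m' f c) (arr ?S n n' h d) =
        day_class A B (m' * n')
         (k * k', l * l', cross n' k l k' l' (f \<circ> v) (h \<circ> w), mul A k k' x x', mul B l l' y y')"
      using c d fh
      by (simp add: day_arr_class'[OF fh(1)] day_arr_class'[OF fh(2)] day_mul_class' del: s_smash_simps(4))
    also have "\<dots> = arr ?S (m * n) (m' * n') (smash_map n n' f h) (mul ?S m n c d)"
      unfolding c(1) d(1) day_mul_class'[OF c(2-4) d(2-4)] using c d mem fh
      by (simp add: day_arr_class'[OF smash_map_gmaps[OF fh]] cross_comp[OF c(2) d(2) fh]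
          del: s_smash_simps(4))
    finally show "mul ?S m' n' (arr ?S m m' f c) (arr ?S n n' h d) =
      arr ?S (m * n) (m' * n') (smash_map n n' f h) (mul ?S m n c d)" .
  next
    fix m n d assume "d \<in> obj ?S n"
    then obtain t where t: "d = day_class A B n t" "t \<in> day_elts A B n"
      by (auto elim!: day_obj_cases simp: day_elts_def)
    obtain s where s: "s \<in> day_axes A B m" "bpt (day A B) m = day_class A B m s"
      by (rule day_bpt_cases)
    have se: "s \<in> day_elts A B m" using s by (auto simp: day_axes_def)
    show "mul ?S m n (bpt ?S m) d = bpt ?S (m * n)"
      using day_class_axes[OF mul_axes[OF se t(2)]] s t day_mul_class[OF se t(2)]
      by (simp del: s_smash_simps(4))
  next
    fix m n c assume "c \<in> obj ?S m"
    then obtain s where s: "c = day_class A B m s" "s \<in> day_elts A B m"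
      by (auto elim!: day_obj_cases simp: day_elts_def)
    obtain t where t: "t \<in> day_axes A B n" "bpt (day A B) n = day_class A B n t"
      by (rule day_bpt_cases)
    have te: "t \<in> day_elts A B n" using t by (auto simp: day_axes_def)
    show "mul ?S m n c (bpt ?S n) = bpt ?S (m * n)"
      using day_class_axes[OF mul_axes[OF s(2) te]] s t day_mul_class[OF s(2) te]
      by (simp del: s_smash_simps(4))
  qed
  have oneB: "one B 1 1 \<in> obj B 1" by (rule s_algebraD(7)[OF B]) simp
  have hom: "gamma_hom sphere ?S (one ?S)"
    unfolding gamma_hom_def
  proof (intro conjI allI ballI)
    fix n i assume "i \<in> obj sphere n"
    then show "one ?S n i \<in> obj ?S n"
      using one_smash_elt[of i n] by (simp add: sphere_def day_class_mem)
  next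
    fix n show "one ?S n (bpt sphere n) = bpt ?S n"
      using one_smash_elt[of 0 n]
      by (simp add: sphere_def s_algebraD(9)[OF A] day_class_axes day_axes_def)
  next
    fix m n f i assume f: "f \<in> gmaps m n" and i: "i \<in> obj sphere m"
    have i': "i \<le> m" using i by (simp add: sphere_def)
    have sm: "gid n \<circ> smash_map 1 1 f (gid 1) = f"
    proof -
      have "smash_map 1 1 f (gid 1) = f"
      proof (rule gmaps_ext_pair[of _ m 1 "n * 1" _ n])
        fix a b :: nat assume "a \<le> m" "b \<le> 1"
        then have "smash_map 1 1 f (gid 1) (spair 1 a b) = spair 1 (f a) b"
          using smash_map_spair[OF f gid_gmaps[of 1], of b a] by (simp add: gid_def)
        also have "\<dots> = f (spair 1 a b)"
          using gmapsD(1)[OF f] \<open>b \<le> 1\<close> by (cases "b = 0") (auto simp: spair_def le_Suc_eq)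
        finally show "smash_map 1 1 f (gid 1) (spair 1 a b) = f (spair 1 a b)" .
      qed (use f smash_map_gmaps[OF f gid_gmaps[of 1]] in auto)
      then show ?thesis using f by simp
    qed
    have "day_eq A B n (m, 1, gid n \<circ> smash_map 1 1 f (gid 1), one A m i, one B 1 1)
       (n, 1, gid n, arr A m n f (one A m i), arr B 1 1 (gid 1) (one B 1 1))"
      using f s_algebraD(7)[OF A i'] oneB by (intro day_eq.transition) auto
    then have "day_eq A B n (m, 1, f, one A m i, one B 1 1) (n, 1, gid n, one A n (f i), one B 1 1)"
      unfolding sm s_algebraD(8)[OF A i' f] gamma_setD(4)[OF G oneB] .
    then have "one ?S n (f i) = day_class A B n (m, 1, f, one A m i, one B 1 1)"
      by (simp add: day_class_eqI)
    also have "\<dots> = arr ?S m n f (one ?S m i)"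
      using f s_algebraD(7)[OF A i'] oneB by (simp add: day_arr_class'[OF f])
    finally show "one ?S n (arr sphere m n f i) = arr ?S m n f (one ?S m i)"
      by (simp add: sphere_def)
  qed
  have assoc: "mul ?S (m * n) p (mul ?S m n c d) e = mul ?S m (n * p) c (mul ?S n p d e)"
    if cde: "c \<in> obj ?S m" "d \<in> obj ?S n" "e \<in> obj ?S p" for m n p c d e
  proof -
    obtain k l u x y where c: "c = day_class A B m (k, l, u, x, y)"
      "u \<in> gmaps (k * l) m" "x \<in> obj A k" "y \<in> obj B l"
      using cde by (auto elim: day_obj_cases)
    obtain k' l' v x' y' where d: "d = day_class A B n (k', l', v, x', y')"
      "v \<in> gmaps (k' * l') n" "x' \<in> obj A k'" "y' \<in> obj B l'"
      using cde by (auto elim: day_obj_cases)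
    obtain k'' l'' w x'' y'' where e: "e = day_class A B p (k'', l'', w, x'', y'')"
      "w \<in> gmaps (k'' * l'') p" "x'' \<in> obj A k''" "y'' \<in> obj B l''"
      using cde by (auto elim: day_obj_cases)
    note mA = bimorphismD(1)[OF s_algebraD(2)[OF A]]
    note mB = bimorphismD(1)[OF s_algebraD(2)[OF B]]
    show ?thesis
      unfolding c(1) d(1) e(1) day_mul_class'[OF c(2-4) d(2-4)] day_mul_class'[OF d(2-4) e(2-4)]
        day_mul_class'[OF cross_gmaps[OF c(2) d(2)] mA[OF c(3) d(3)] mB[OF c(4) d(4)] e(2-4)]
        day_mul_class'[OF c(2-4) cross_gmaps[OF d(2) e(2)] mA[OF d(3) e(3)] mB[OF d(4) e(4)]]
        cross_assoc[OF c(2) d(2) e(2)] s_algebraD(4)[OF A c(3) d(3) e(3)]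
        s_algebraD(4)[OF B c(4) d(4) e(4)]
      by (simp add: mult.assoc)
  qed
  have left: "mul ?S m n (one ?S m i) c = arr ?S n (m * n) (sleft n i) c"
    if i: "i \<le> m" and cde: "c \<in> obj ?S n" for m n i c
  proof -
    obtain k l v x y where c: "c = day_class A B n (k, l, v, x, y)"
      "v \<in> gmaps (k * l) n" "x \<in> obj A k" "y \<in> obj B l"
      using cde by (auto elim: day_obj_cases)
    note oneA = s_algebraD(7)[OF A i]
    have gm: "gid m \<in> gmaps (m * 1) m" by simp
    have yy: "mul B 1 l (one B 1 1) y = arr B l (1 * l) (gid l) y"
    proof -
      have "sleft l 1 = gid l" by (auto simp: sleft_def gid_def spair_def fun_eq_iff)
      then show ?thesis using s_algebraD(5)[OF B _ c(4), of 1 1] by simp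
    qed
    have "mul ?S m n (one ?S m i) c = day_class A B (m * n)
        (m * k, 1 * l, cross n m 1 k l (gid m) v, arr A k (m * k) (sleft k i) x, arr B l (1 * l) (gid l) y)"
      unfolding one_smash_cases[OF i] c(1) day_mul_class'[OF gm oneA oneB c(2-4)]
        s_algebraD(5)[OF A i c(3)] yy ..
    also have "\<dots> = day_class A B (m * n)
        (k, l, cross n m 1 k l (gid m) v \<circ> smash_map l (1 * l) (sleft k i) (gid l), x, y)"
      using c i cross_gmaps[OF gm c(2)]
      by (intro day_class_eqI day_eq.sym[OF day_eq.transition]) auto
    also have "cross n m 1 k l (gid m) v \<circ> smash_map l (1 * l) (sleft k i) (gid l) = sleft n i \<circ> v"
    proof (rule gmaps_ext_pair)
      have sl: "sleft k i \<in> gmaps k (m * k)" "gid l \<in> gmaps l (1 * l)" using i by auto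
      show "cross n m 1 k l (gid m) v \<circ> smash_map l (1 * l) (sleft k i) (gid l) \<in> gmaps (k * l) (m * n)"
        using cross_gmaps[OF gm c(2)] sl by (intro gmaps_comp[OF smash_map_gmaps]) auto
      show "sleft n i \<circ> v \<in> gmaps (k * l) (m * n)" using c i by blast
      fix a b assume ab: "a \<le> k" "b \<le> l"
      have "smash_map l (1 * l) (sleft k i) (gid l) (spair l a b) =
          spair (1 * l) (spair k i a) (spair l 1 b)"
        using ab smash_map_spair[OF sl ab(2), of a] by (simp add: sleft_def gid_def) (simp add: spair_def)
      then show "(cross n m 1 k l (gid m) v \<circ> smash_map l (1 * l) (sleft k i) (gid l)) (spair l a b)
          = (sleft n i \<circ> v) (spair l a b)"
        using cross_spair[OF gm c(2) i ab(1) _ ab(2), of 1] i gmaps_le[OF c(2), of "spair l a b"]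
        by (simp add: gid_def sleft_def) (simp add: spair_def)
    qed
    also have "day_class A B (m * n) (k, l, sleft n i \<circ> v, x, y) = arr ?S n (m * n) (sleft n i) c"
      using c i by (simp add: day_arr_class'[OF sleft_gmaps[OF i]])
    finally show ?thesis .
  qed
  have right: "mul ?S m n c (one ?S n j) = arr ?S m (m * n) (sright m n j) c"
    if j: "j \<le> n" and cde: "c \<in> obj ?S m" for m n j c
  proof -
    obtain k l v x y where c: "c = day_class A B m (k, l, v, x, y)"
      "v \<in> gmaps (k * l) m" "x \<in> obj A k" "y \<in> obj B l"
      using cde by (auto elim: day_obj_cases)
    note oneA = s_algebraD(7)[OF A j]
    have gm: "gid n \<in> gmaps (n * 1) n" by simp
    have yy: "mul B l 1 y (one B 1 1) = arr B l (l * 1) (gid l) y"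
    proof -
      have "sright l 1 1 = gid l" by (auto simp: sright_def gid_def spair_def fun_eq_iff)
      then show ?thesis using s_algebraD(6)[OF B _ c(4), of 1 1] by simp
    qed
    have "mul ?S m n c (one ?S n j) = day_class A B (m * n)
        (k * n, l * 1, cross n k l n 1 v (gid n), arr A k (k * n) (sright k n j) x, arr B l (l * 1) (gid l) y)"
      unfolding one_smash_cases[OF j] c(1) day_mul_class'[OF c(2-4) gm oneA oneB]
        s_algebraD(6)[OF A j c(3)] yy ..
    also have "\<dots> = day_class A B (m * n)
        (k, l, cross n k l n 1 v (gid n) \<circ> smash_map l (l * 1) (sright k n j) (gid l), x, y)"
      using c j cross_gmaps[OF c(2) gm]
      by (intro day_class_eqI day_eq.sym[OF day_eq.transition]) auto
    also have "cross n k l n 1 v (gid n) \<circ> smash_map l (l * 1) (sright k n j) (gid l) = sright m n j \<circ> v"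
    proof (rule gmaps_ext_pair)
      have sl: "sright k n j \<in> gmaps k (k * n)" "gid l \<in> gmaps l (l * 1)" using j by auto
      show "cross n k l n 1 v (gid n) \<circ> smash_map l (l * 1) (sright k n j) (gid l) \<in> gmaps (k * l) (m * n)"
        using cross_gmaps[OF c(2) gm] sl by (intro gmaps_comp[OF smash_map_gmaps]) auto
      show "sright m n j \<circ> v \<in> gmaps (k * l) (m * n)" using c j by blast
      fix a b assume ab: "a \<le> k" "b \<le> l"
      have "smash_map l (l * 1) (sright k n j) (gid l) (spair l a b) =
          spair (l * 1) (spair n a j) (spair 1 b 1)"
        using ab smash_map_spair[OF sl ab(2), of a] by (simp add: sright_def gid_def) (simp add: spair_def)
      then show "(cross n k l n 1 v (gid n) \<circ> smash_map l (l * 1) (sright k n j) (gid l)) (spair l a b)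
          = (sright m n j \<circ> v) (spair l a b)"
        using cross_spair[OF c(2) gm ab(1) j ab(2), of 1] j gmaps_le[OF c(2), of "spair l a b"]
        by (simp add: gid_def sright_def) (simp add: spair_def)
    qed
    also have "day_class A B (m * n) (k, l, sright m n j \<circ> v, x, y) = arr ?S m (m * n) (sright m n j) c"
      using c j by (simp add: day_arr_class'[OF sright_gmaps[OF j]])
    finally show ?thesis .
  qed
  show ?thesis
    unfolding is_s_algebra_def using g bim hom assoc left right by blast
qed

end

subsection \<open>\<open>H\<int>\<close> is an \<open>\<S>\<close>-algebra\<close>

lemma spair_inj:
  assumes "0 < i" "0 < j" "j \<le> l" "j' \<le> l"
  shows "spair l i' j' = spair l i j \<longleftrightarrow> i' = i \<and> j' = j"
proof
  assume eq: "spair l i' j' = spair l i j"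
  then have "0 < i'" "0 < j'"
    using assms by (metis spair_gt_0_iff)+
  then show "i' = i \<and> j' = j"
    using eq assms by (metis sfst_spair ssnd_spair)
qed simp

lemma sum_spair: "(\<Sum>p\<in>{1..k * l}. h p) = (\<Sum>i\<in>{1..k}. \<Sum>j\<in>{1..l}. h (spair l i j))"
proof -
  have "(\<Sum>i\<in>{1..k}. \<Sum>j\<in>{1..l}. h (spair l i j)) = (\<Sum>(i, j)\<in>{1..k} \<times> {1..l}. h (spair l i j))"
    by (rule sum.cartesian_product)
  also have "\<dots> = (\<Sum>p\<in>{1..k * l}. h p)"
  proof (rule sum.reindex_bij_witness[where i = "\<lambda>p. (sfst l p, ssnd l p)" and j = "\<lambda>(i, j). spair l i j"])
    fix a assume "a \<in> {1..k} \<times> {1..l}"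
    then show "(sfst l (case a of (i, j) \<Rightarrow> spair l i j), ssnd l (case a of (i, j) \<Rightarrow> spair l i j)) = a"
      "(case a of (i, j) \<Rightarrow> spair l i j) \<in> {1..k * l}"
      by (auto simp: sfst_spair ssnd_spair spair_le Suc_le_eq)
  next
    fix p assume "p \<in> {1..k * l}"
    then show "(case (sfst l p, ssnd l p) of (i, j) \<Rightarrow> spair l i j) = p"
      "(sfst l p, ssnd l p) \<in> {1..k} \<times> {1..l}"
      by (auto simp: sfst_le ssnd_le Suc_le_eq) (auto simp: sfst_def ssnd_def)
  qed auto
  finally show ?thesis ..
qed

lemma HZ_simps:
  "\<phi> \<in> obj HZ n \<longleftrightarrow> (\<forall>i. i \<notin> {1..n} \<longrightarrow> \<phi> i = 0)"
  "bpt HZ n = (\<lambda>_. 0)"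
  "arr HZ m n f \<phi> = (\<lambda>y. if y \<in> {1..n} then \<Sum>x\<in>{1..m}. if f x = y then \<phi> x else 0 else 0)"
  "mul HZ k l \<phi> \<psi> = (\<lambda>p. if p \<in> {1..k * l} then \<phi> (sfst l p) * \<psi> (ssnd l p) else 0)"
  "one HZ n i = (\<lambda>j. if j \<in> {1..n} \<and> i = j then 1 else 0)"
proof -
  have "(\<Sum>x | x \<in> {1..m} \<and> f x = y. \<phi> x) = (\<Sum>x\<in>{1..m}. if f x = y then \<phi> x else 0)" for y
    by (rule sum.inter_filter) simp
  then show "arr HZ m n f \<phi> = (\<lambda>y. if y \<in> {1..n} then \<Sum>x\<in>{1..m}. if f x = y then \<phi> x else 0 else 0)"
    by (simp only: HZ_def s_algebra.simps gamma_set.simps)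
qed (simp_all add: HZ_def)

lemma HZ_mul_spair:
  "\<lbrakk>0 < i; i \<le> k; 0 < j; j \<le> l\<rbrakk> \<Longrightarrow> mul HZ k l \<phi> \<psi> (spair l i j) = \<phi> i * \<psi> j"
  by (simp add: HZ_simps sfst_spair ssnd_spair spair_le Suc_le_eq)

lemma HZ_ext_pair:
  assumes "\<phi> \<in> obj HZ (k * l)" "\<psi> \<in> obj HZ (k * l)"
    "\<And>i j. \<lbrakk>0 < i; i \<le> k; 0 < j; j \<le> l\<rbrakk> \<Longrightarrow> \<phi> (spair l i j) = \<psi> (spair l i j)"
  shows "\<phi> = \<psi>"
proof
  fix p show "\<phi> p = \<psi> p"
  proof (cases "p \<in> {1..k * l}")
    case True
    then have "p \<le> k * l" by simp
    then show ?thesis by (cases rule: spair_cases) (use True assms(3) in auto)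
  qed (use assms(1,2) in \<open>auto simp: HZ_simps\<close>)
qed

lemma HZ_mem [simp, intro]:
  "mul HZ k l \<phi> \<psi> \<in> obj HZ (k * l)" "arr HZ m n f \<phi> \<in> obj HZ n" "one HZ n i \<in> obj HZ n"
  "bpt HZ n \<in> obj HZ n"
  by (simp_all add: HZ_simps)

lemma is_gamma_set_HZ: "is_gamma_set HZ"
  unfolding is_gamma_set_def
proof (intro conjI allI ballI)
  fix m n p f g \<phi>
  show "arr HZ n n (gid n) \<phi> = \<phi>" if "\<phi> \<in> obj HZ n"
  proof
    fix y
    have "(\<Sum>x\<in>{1..n}. if gid n x = y then \<phi> x else 0) = (\<Sum>x\<in>{1..n}. if x = y then \<phi> x else 0)"
      by (rule sum.cong) (auto simp: gid_def)
    then show "arr HZ n n (gid n) \<phi> y = \<phi> y" using that by (simp add: HZ_simps)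
  qed
  assume f: "f \<in> gmaps m n" and g: "g \<in> gmaps n p"
  show "arr HZ m p (g \<circ> f) \<phi> = arr HZ n p g (arr HZ m n f \<phi>)"
  proof
    fix z
    have "(\<Sum>y\<in>{1..n}. if g y = z then \<Sum>x\<in>{1..m}. if f x = y then \<phi> x else 0 else 0)
      = (\<Sum>x\<in>{1..m}. if g (f x) = z then \<phi> x else 0)" if z: "z \<in> {1..p}"
    proof -
      have "(\<Sum>y\<in>{1..n}. if g y = z then \<Sum>x\<in>{1..m}. if f x = y then \<phi> x else 0 else 0)
        = (\<Sum>y\<in>{1..n}. \<Sum>x\<in>{1..m}. if y = f x then (if g (f x) = z then \<phi> x else 0) else 0)"
      proof (rule sum.cong)
        fix y
        show "(if g y = z then \<Sum>x\<in>{1..m}. if f x = y then \<phi> x else 0 else 0) =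
            (\<Sum>x\<in>{1..m}. if y = f x then (if g (f x) = z then \<phi> x else 0) else 0)"
          by (cases "g y = z") (auto intro!: sum.cong sum.neutral)
      qed simp
      also have "\<dots> = (\<Sum>x\<in>{1..m}. \<Sum>y\<in>{1..n}. if y = f x then (if g (f x) = z then \<phi> x else 0) else 0)"
        by (rule sum.swap)
      also have "\<dots> = (\<Sum>x\<in>{1..m}. if g (f x) = z then \<phi> x else 0)"
      proof (rule sum.cong)
        fix x
        have "f x \<le> n" using f by (rule gmaps_le)
        moreover have "f x \<noteq> 0" if "g (f x) = z" using that z gmapsD(1)[OF g] by (metis atLeastAtMost_iff not_one_le_zero)
        ultimately show "(\<Sum>y\<in>{1..n}. if y = f x then (if g (f x) = z then \<phi> x else 0) else 0)
           = (if g (f x) = z then \<phi> x else 0)"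
          by (auto simp: sum.delta Suc_le_eq)
      qed simp
      finally show ?thesis .
    qed
    then show "arr HZ m p (g \<circ> f) \<phi> z = arr HZ n p g (arr HZ m n f \<phi>) z"
      by (simp add: HZ_simps cong: if_cong)
  qed
qed (auto simp: HZ_simps)

lemma bimorphism_HZ: "bimorphism HZ HZ HZ (mul HZ)"
  unfolding bimorphism_def
proof (intro conjI allI ballI)
  fix k k' l l' f g \<phi> \<psi>
  assume f: "f \<in> gmaps k k'" and g: "g \<in> gmaps l l'"
  show "mul HZ k' l' (arr HZ k k' f \<phi>) (arr HZ l l' g \<psi>) =
    arr HZ (k * l) (k' * l') (smash_map l l' f g) (mul HZ k l \<phi> \<psi>)"
  proof (rule HZ_ext_pair)
    fix i j assume ij: "0 < i" "i \<le> k'" "0 < j" "j \<le> l'"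
    have "arr HZ (k * l) (k' * l') (smash_map l l' f g) (mul HZ k l \<phi> \<psi>) (spair l' i j) =
      (\<Sum>p\<in>{1..k * l}. if smash_map l l' f g p = spair l' i j then mul HZ k l \<phi> \<psi> p else 0)"
      using ij spair_le[OF ij(2,4)] by (simp add: HZ_simps(3) Suc_le_eq)
    also have "\<dots> = (\<Sum>a\<in>{1..k}. \<Sum>b\<in>{1..l}.
        if f a = i \<and> g b = j then \<phi> a * \<psi> b else 0)"
      unfolding sum_spair
      by (intro sum.cong refl)
        (auto simp: smash_map_spair[OF f g] HZ_mul_spair spair_inj[OF ij(1,3,4) gmaps_le[OF g]] Suc_le_eq)
    also have "\<dots> = (\<Sum>a\<in>{1..k}. if f a = i then \<phi> a else 0) * (\<Sum>b\<in>{1..l}. if g b = j then \<psi> b else 0)"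
      unfolding sum_product by (intro sum.cong refl) auto
    also have "\<dots> = mul HZ k' l' (arr HZ k k' f \<phi>) (arr HZ l l' g \<psi>) (spair l' i j)"
      using ij by (simp add: HZ_mul_spair) (simp add: HZ_simps(3) Suc_le_eq)
    finally show "mul HZ k' l' (arr HZ k k' f \<phi>) (arr HZ l l' g \<psi>) (spair l' i j) =
      arr HZ (k * l) (k' * l') (smash_map l l' f g) (mul HZ k l \<phi> \<psi>) (spair l' i j)" ..
  qed auto
qed (auto simp: HZ_simps)

theorem is_s_algebra_HZ: "is_s_algebra HZ"
  unfolding is_s_algebra_def
proof (intro conjI allI ballI impI)
  show "is_gamma_set HZ" by (rule is_gamma_set_HZ)
  show "bimorphism HZ HZ HZ (mul HZ)" by (rule bimorphism_HZ)
  show "gamma_hom sphere HZ (one HZ)"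
    unfolding gamma_hom_def
  proof (intro conjI allI ballI)
    fix m n f i assume f: "f \<in> gmaps m n" and "i \<in> obj sphere m"
    then have i: "i \<le> m" by (simp add: sphere_def)
    show "one HZ n (arr sphere m n f i) = arr HZ m n f (one HZ m i)"
    proof
      fix y
      have "(\<Sum>x\<in>{1..m}. if f x = y then (if x \<in> {1..m} \<and> i = x then 1 else 0) else 0 :: int)
        = (\<Sum>x\<in>{1..m}. if x = i then (if f i = y then 1 else 0) else 0)"
        by (intro sum.cong) auto
      also have "\<dots> = (if 1 \<le> i \<and> f i = y then 1 else 0)" using i by (simp add: sum.delta)
      finally show "one HZ n (arr sphere m n f i) y = arr HZ m n f (one HZ m i) y"
        unfolding HZ_simps sphere_def using gmapsD(1)[OF f]
        by (cases "i = 0"; cases "y = 0") (auto simp del: atLeastAtMost_iff, simp_all)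
    qed
  qed (auto simp: HZ_simps sphere_def)
next
  fix k l m \<phi> \<psi> \<chi>
  show "mul HZ (k * l) m (mul HZ k l \<phi> \<psi>) \<chi> = mul HZ k (l * m) \<phi> (mul HZ l m \<psi> \<chi>)"
  proof (rule HZ_ext_pair[of _ "k * l" m])
    fix q h assume qh: "0 < q" "q \<le> k * l" "0 < h" "h \<le> m"
    from qh(2) obtain i j where q: "q = spair l i j" "0 < i" "i \<le> k" "0 < j" "j \<le> l"
      by (rule spair_cases) (use qh in auto)
    have "mul HZ k (l * m) \<phi> (mul HZ l m \<psi> \<chi>) (spair (l * m) i (spair m j h)) = \<phi> i * (\<psi> j * \<chi> h)"
      using qh q by (subst HZ_mul_spair) (auto simp: spair_le HZ_mul_spair)
    then show "mul HZ (k * l) m (mul HZ k l \<phi> \<psi>) \<chi> (spair m q h) =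
        mul HZ k (l * m) \<phi> (mul HZ l m \<psi> \<chi>) (spair m q h)"
      using qh q by (simp add: HZ_mul_spair spair_assoc[symmetric] spair_le)
  qed (use HZ_mem(1)[of k "l * m"] HZ_mem(1)[of "k * l" m] in \<open>auto simp: mult.assoc\<close>)
next
  fix m n i :: nat and \<phi> assume i: "i \<le> m" "\<phi> \<in> obj HZ n"
  show "mul HZ m n (one HZ m i) \<phi> = arr HZ n (m * n) (sleft n i) \<phi>"
  proof (rule HZ_ext_pair)
    fix a b assume ab: "0 < a" "a \<le> m" "0 < b" "b \<le> n"
    have "arr HZ n (m * n) (sleft n i) \<phi> (spair n a b) =
        (\<Sum>x\<in>{1..n}. if sleft n i x = spair n a b then \<phi> x else 0)"
      using ab spair_le[OF ab(2,4)] by (simp add: HZ_simps(3) Suc_le_eq)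
    also have "\<dots> = (\<Sum>x\<in>{1..n}. if x = b then (if i = a then \<phi> x else 0) else 0)"
      by (intro sum.cong refl) (auto simp: sleft_def spair_inj[OF ab(1,3,4)])
    also have "\<dots> = one HZ m i a * \<phi> b" using ab by (simp add: sum.delta HZ_simps(5))
    finally show "mul HZ m n (one HZ m i) \<phi> (spair n a b) = arr HZ n (m * n) (sleft n i) \<phi> (spair n a b)"
      using ab by (simp add: HZ_mul_spair)
  qed auto
next
  fix m n j :: nat and \<phi> assume j: "j \<le> n" "\<phi> \<in> obj HZ m"
  show "mul HZ m n \<phi> (one HZ n j) = arr HZ m (m * n) (sright m n j) \<phi>"
  proof (rule HZ_ext_pair)
    fix a b assume ab: "0 < a" "a \<le> m" "0 < b" "b \<le> n"
    have "arr HZ m (m * n) (sright m n j) \<phi> (spair n a b) =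
        (\<Sum>x\<in>{1..m}. if sright m n j x = spair n a b then \<phi> x else 0)"
      using ab spair_le[OF ab(2,4)] by (simp add: HZ_simps(3) Suc_le_eq)
    also have "\<dots> = (\<Sum>x\<in>{1..m}. if x = a then (if j = b then \<phi> x else 0) else 0)"
      by (intro sum.cong refl) (auto simp: sright_def spair_inj[OF ab(1,3,4) j(1)])
    also have "\<dots> = \<phi> a * one HZ n j b" using ab by (simp add: sum.delta HZ_simps(5))
    finally show "mul HZ m n \<phi> (one HZ n j) (spair n a b) = arr HZ m (m * n) (sright m n j) \<phi> (spair n a b)"
      using ab by (simp add: HZ_mul_spair)
  qed auto
qed

corollary is_s_algebra_HZ_HZ: "is_s_algebra (s_smash HZ HZ)"
proof -
  interpret two_s_algebras HZ HZ by unfold_locales (rule is_s_algebra_HZ)+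
  show ?thesis by (rule is_s_algebra_smash)
qed

end

theory Submission
  imports Defs
begin

text \<open>
  An element of \<open>(H\<int> \<and> H\<int>)(1\<^sub>+)\<close> is represented by a 0/1-matrix \<open>v\<close> with weights \<open>x\<close> on the rows
  and \<open>y\<close> on the columns.  Let \<open>s\<^sub>i\<close> be the \<open>y\<close>-weighted sum of row \<open>i\<close>.  The element
  \<open>\<Sum> x\<^sub>i [s\<^sub>i]\<close> of \<open>\<int>[\<int>] / \<int>[0]\<close> is invariant under the relations of the Day convolution: merging
  columns does not change the \<open>s\<^sub>i\<close>, and merging rows adds the weights of equal \<open>s\<^sub>i\<close>.  It
  distinguishes the \<open>2 \<times> 1\<close> from the \<open>1 \<times> 2\<close> all-one matrix, with all weights 1 (the values are
  \<open>2[1]\<close> and \<open>[2]\<close>).  Every unital map to \<open>H\<int>\<close> identifies the two: each is the image under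
  the fold map \<open>2\<^sub>+ \<rightarrow> 1\<^sub>+\<close> of an element of \<open>(H\<int> \<and> H\<int>)(2\<^sub>+)\<close> both of whose projections to
  \<open>1\<^sub>+\<close> are the unit, and an element of \<open>H\<int>(2\<^sub>+)\<close> is determined by its projections.
\<close>

definition row_sum :: "nat \<Rightarrow> (nat \<Rightarrow> nat) \<Rightarrow> (nat \<Rightarrow> int) \<Rightarrow> nat \<Rightarrow> int" where
  "row_sum l v y i = (\<Sum>j\<in>{1..l}. if v (spair l i j) = 1 then y j else 0)"

text \<open>The coefficient of [z]. It is an invariant of classes only for z \<noteq> 0, as [0] is
  divided out.\<close>

fun row_weight :: "int \<Rightarrow> (nat \<Rightarrow> int, nat \<Rightarrow> int) day_elt \<Rightarrow> int" where
  "row_weight z (k, l, v, x, y) = (\<Sum>i\<in>{1..k}. if row_sum l v y i = z then x i else 0)"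

text \<open>Swapping the two sums leaves one term per x, at y = \<open>f x\<close>.
  \<open>\<not> P 0\<close> matches the loss of the weights that \<open>f\<close> sends to the base
  point.\<close>

lemma sum_arr_HZ:
  assumes f: "f \<in> gmaps m n" and P: "\<not> P 0"
  shows "(\<Sum>y\<in>{1..n}. if P y then arr HZ m n f \<phi> y else 0) = (\<Sum>x\<in>{1..m}. if P (f x) then \<phi> x else 0)"
proof -
  have "(\<Sum>y\<in>{1..n}. if P y then arr HZ m n f \<phi> y else 0)
      = (\<Sum>y\<in>{1..n}. \<Sum>x\<in>{1..m}. if y = f x then (if P (f x) then \<phi> x else 0) else 0)"
  proof (rule sum.cong)
    fix y assume "y \<in> {1..n}"
    then show "(if P y then arr HZ m n f \<phi> y else 0)
        = (\<Sum>x\<in>{1..m}. if y = f x then (if P (f x) then \<phi> x else 0) else 0)"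
      by (cases "P y") (auto simp: HZ_simps(3) intro!: sum.cong sum.neutral)
  qed simp
  also have "\<dots> = (\<Sum>x\<in>{1..m}. \<Sum>y\<in>{1..n}. if y = f x then (if P (f x) then \<phi> x else 0) else 0)"
    by (rule sum.swap)
  also have "\<dots> = (\<Sum>x\<in>{1..m}. if P (f x) then \<phi> x else 0)"
  proof (rule sum.cong)
    fix x
    have "f x \<noteq> 0" if "P (f x)" using that P by metis
    then show "(\<Sum>y\<in>{1..n}. if y = f x then (if P (f x) then \<phi> x else 0) else 0)
        = (if P (f x) then \<phi> x else 0)"
      using gmaps_le[OF f, of x] by (auto simp: Suc_le_eq)
  qed simp
  finally show ?thesis .
qed

lemma row_sum_transition:
  assumes f: "f \<in> gmaps k k'" and g: "g \<in> gmaps l l'" and v: "v \<in> gmaps (k' * l') 1"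
  shows "row_sum l (v \<circ> smash_map l l' f g) y i = row_sum l' v (arr HZ l l' g y) (f i)"
proof -
  have "row_sum l (v \<circ> smash_map l l' f g) y i
      = (\<Sum>j\<in>{1..l}. if v (spair l' (f i) (g j)) = 1 then y j else 0)"
    unfolding row_sum_def by (intro sum.cong) (auto simp: smash_map_spair[OF f g])
  also have "\<dots> = row_sum l' v (arr HZ l l' g y) (f i)"
    unfolding row_sum_def
    by (rule sum_arr_HZ[OF g, symmetric]) (simp add: gmapsD(1)[OF v])
  finally show ?thesis .
qed

text \<open>If x is zero, all weights vanish; if y is zero, every row sum is 0 and hence differs
  from z.\<close>

lemma row_weight_axes:
  assumes "t \<in> day_axes HZ HZ 1" "z \<noteq> 0"
  shows "row_weight z t = 0"
proof -
  obtain k l v x y where t: "t = (k, l, v, x, y)" "x = bpt HZ k \<or> y = bpt HZ l"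
    using assms(1) by (auto simp: day_axes_def)
  have "row_sum l v y i = 0" if "y = bpt HZ l" for i
    by (simp add: row_sum_def that HZ_simps cong: if_cong)
  then show ?thesis
    using t assms(2) by (auto simp: HZ_simps intro: sum.neutral)
qed

lemma row_weight_day_eq:
  assumes "day_eq HZ HZ 1 s t" "z \<noteq> 0"
  shows "row_weight z s = row_weight z t"
  using assms(1)
proof induction
  case (transition f k k' g l l' v x y)
  \<comment> \<open>Row 0 has sum 0 \<noteq> z, so \<open>sum_arr_HZ\<close> applies along
    \<open>f\<close> to the predicate that the row sum is z.\<close>
  have "row_sum l' v (arr HZ l l' g y) 0 = 0"
    by (simp add: row_sum_def gmapsD(1)[OF transition(3)])
  then show ?case
    using sum_arr_HZ[OF transition(1), of "\<lambda>i. row_sum l' v (arr HZ l l' g y) i = z" x] assms(2)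
    by (simp add: row_sum_transition[OF transition(1-3)])
qed (use row_weight_axes assms(2) in auto)

definition ones :: "nat \<Rightarrow> nat \<Rightarrow> int" where
  "ones n = (\<lambda>i. if i \<in> {1..n} then 1 else 0)"

definition proj :: "nat \<Rightarrow> nat \<Rightarrow> nat" where
  "proj p = (\<lambda>i. if i = p then 1 else 0)"

definition gfold :: "nat \<Rightarrow> nat \<Rightarrow> nat" where
  "gfold n = (\<lambda>i. if i \<in> {1..n} then 1 else 0)"

lemma ones_mem [simp]: "ones n \<in> obj HZ n"
  by (simp add: ones_def HZ_simps)

lemma ones_eq_1: "\<lbrakk>0 < i; i \<le> n\<rbrakk> \<Longrightarrow> ones n i = 1"
  by (simp add: ones_def)

lemma proj_gmaps: "\<lbrakk>0 < p; p \<le> n\<rbrakk> \<Longrightarrow> proj p \<in> gmaps n 1"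
  by (auto simp: proj_def gmaps_def)

lemma gfold_gmaps: "gfold n \<in> gmaps n 1"
  by (auto simp: gfold_def gmaps_def)

lemma arr_HZ_proj:
  assumes "0 < p" "p \<le> n"
  shows "arr HZ n 1 (proj p) \<phi> = (\<lambda>i. if i = 1 then \<phi> p else 0)"
proof -
  have "(\<Sum>x\<in>{1..n}. if proj p x = 1 then \<phi> x else 0) = (\<Sum>x\<in>{1..n}. if x = p then \<phi> x else 0)"
    by (intro sum.cong) (auto simp: proj_def)
  then show ?thesis
    using assms by (auto simp: HZ_simps(3) fun_eq_iff)
qed

lemma arr_HZ_proj_ones:
  assumes "0 < p" "p \<le> n"
  shows "arr HZ n 1 (proj p) (ones n) = one HZ 1 1"
proof
  fix i :: nat
  have "(i \<in> {1..1} \<and> 1 = i) = (i = 1)" by auto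
  then show "arr HZ n 1 (proj p) (ones n) i = one HZ 1 1 i"
    by (simp only: arr_HZ_proj[OF assms] ones_eq_1[OF assms] HZ_simps(5))
qed

text \<open>Writes a projection of the smash product in the form of a transition map of the
  colimit.\<close>

lemma proj_smash:
  assumes "0 < i" "i \<le> k" "0 < j" "j \<le> l"
  shows "proj (spair l i j) = smash_map l 1 (proj i) (proj j)"
proof (rule gmaps_ext_pair)
  have pi: "proj i \<in> gmaps k 1" and pj: "proj j \<in> gmaps l 1"
    using assms by (blast intro: proj_gmaps)+
  show "proj (spair l i j) \<in> gmaps (k * l) 1"
    using assms by (intro proj_gmaps) (auto simp: spair_le)
  show "smash_map l 1 (proj i) (proj j) \<in> gmaps (k * l) (1 * 1)"
    using pi pj by (rule smash_map_gmaps)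
  fix a b assume "a \<le> k" "b \<le> l"
  then show "proj (spair l i j) (spair l a b) = smash_map l 1 (proj i) (proj j) (spair l a b)"
    unfolding smash_map_spair[OF pi pj \<open>b \<le> l\<close>]
    using spair_inj[OF assms(1,3,4) \<open>b \<le> l\<close>, of a] assms by (auto simp: proj_def spair_def)
qed

interpretation HZ_HZ: two_gamma_sets HZ HZ
  by unfold_locales (rule is_gamma_set_HZ)+

lemma hom_all_ones:
  assumes h: "s_algebra_hom (s_smash HZ HZ) HZ h"
  shows "h (k * l) (day_class HZ HZ (k * l) (k, l, gid (k * l), ones k, ones l)) = ones (k * l)"
    (is "h ?n ?u = _")
proof (rule HZ_ext_pair[of _ k l])
  have hom: "gamma_hom (s_smash HZ HZ) HZ h"
    and unit: "h 1 (one (s_smash HZ HZ) 1 1) = one HZ 1 1"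
    using h by (auto simp: s_algebra_hom_def)
  have u: "?u \<in> obj (s_smash HZ HZ) ?n"
    by (auto simp: day_elts_def intro!: HZ_HZ.day_class_mem)
  show "h ?n ?u \<in> obj HZ ?n"
    using hom u by (simp add: gamma_hom_def)
  fix i j assume ij: "0 < i" "i \<le> k" "0 < j" "j \<le> l"
  let ?p = "spair l i j"
  have p: "0 < ?p" "?p \<le> ?n" using ij by (auto simp: spair_le)
  have "arr (s_smash HZ HZ) ?n 1 (proj ?p) ?u
      = day_class HZ HZ 1 (k, l, gid (1 * 1) \<circ> smash_map l 1 (proj i) (proj j), ones k, ones l)"
    using proj_gmaps[OF p] proj_smash[OF ij]
    by (simp add: HZ_HZ.day_arr_class')
  \<comment> \<open>The transition along \<open>proj i\<close> and \<open>proj j\<close> moves the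
    projections from the matrix to the weights, where they give units.\<close>
  also have "\<dots> = day_class HZ HZ 1 (1, 1, gid (1 * 1), arr HZ k 1 (proj i) (ones k), arr HZ l 1 (proj j) (ones l))"
    using ij by (intro HZ_HZ.day_class_eqI day_eq.transition) (auto intro: proj_gmaps simp del: One_nat_def)
  also have "\<dots> = one (s_smash HZ HZ) 1 1"
    using ij by (simp add: arr_HZ_proj_ones del: One_nat_def)
  finally have "arr HZ ?n 1 (proj ?p) (h ?n ?u) = one HZ 1 1"
    using gamma_homD(3)[OF hom proj_gmaps[OF p] u] unit by simp
  from fun_cong[OF this, of 1] have "h ?n ?u ?p = 1"
    using p by (simp add: arr_HZ_proj[OF p] HZ_simps(5) del: One_nat_def)
  then show "h ?n ?u ?p = ones ?n ?p"
    by (simp only: ones_eq_1[OF p])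
qed simp

text \<open>Naturality of \<open>h\<close> along the fold map. The value depends on k and l only
  through k * l.\<close>

lemma hom_fold_all_ones:
  assumes h: "s_algebra_hom (s_smash HZ HZ) HZ h"
  shows "h 1 (day_class HZ HZ 1 (k, l, gfold (k * l), ones k, ones l))
    = arr HZ (k * l) 1 (gfold (k * l)) (ones (k * l))"
proof -
  let ?u = "day_class HZ HZ (k * l) (k, l, gid (k * l), ones k, ones l)"
  have "arr (s_smash HZ HZ) (k * l) 1 (gfold (k * l)) ?u
      = day_class HZ HZ 1 (k, l, gfold (k * l), ones k, ones l)"
    using gfold_gmaps[of "k * l"] by (simp add: HZ_HZ.day_arr_class' del: One_nat_def)
  moreover have "h 1 (arr (s_smash HZ HZ) (k * l) 1 (gfold (k * l)) ?u)
      = arr HZ (k * l) 1 (gfold (k * l)) (h (k * l) ?u)"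
  proof (rule gamma_homD(3)[OF _ gfold_gmaps])
    show "gamma_hom (s_smash HZ HZ) HZ h"
      using h by (simp add: s_algebra_hom_def)
    show "?u \<in> obj (s_smash HZ HZ) (k * l)"
      by (auto simp: day_elts_def intro!: HZ_HZ.day_class_mem)
  qed
  ultimately show ?thesis
    by (simp only: hom_all_ones[OF h])
qed

lemma day_class_eqD:
  assumes "t \<in> day_elts HZ HZ n" "day_class HZ HZ n s = day_class HZ HZ n t"
  shows "day_eq HZ HZ n s t"
proof -
  have "t \<in> day_class HZ HZ n t"
    using day_eq.refl[OF assms(1)] by (simp add: day_class_def day_rel_def)
  then have "t \<in> day_class HZ HZ n s"
    using assms(2) by simp
  then show ?thesis
    by (simp add: day_class_def day_rel_def)
qed

theorem proposition7p4:
  shows "\<not> s_algebra_iso (s_smash HZ HZ) HZ"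
proof
  assume "s_algebra_iso (s_smash HZ HZ) HZ"
  then obtain h h' where h: "s_algebra_hom (s_smash HZ HZ) HZ h"
    and h': "\<forall>n. \<forall>c\<in>obj (s_smash HZ HZ) n. h' n (h n c) = c"
    unfolding s_algebra_iso_def by blast
  define t where "t k l = (k, l, gfold (k * l), ones k, ones l)" for k l
  have elts: "t k l \<in> day_elts HZ HZ 1" for k l
    using gfold_gmaps by (simp add: t_def day_elts_def)
  then have obj: "day_class HZ HZ 1 (t k l) \<in> obj (s_smash HZ HZ) 1" for k l
    by (simp add: HZ_HZ.day_class_mem)
  have two: "{1..2} = {1, 2 :: nat}" by auto
  have "h 1 (day_class HZ HZ 1 (t 2 1)) = h 1 (day_class HZ HZ 1 (t 1 2))"
    using hom_fold_all_ones[OF h, of 2 1] hom_fold_all_ones[OF h, of 1 2] by (simp add: t_def)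
  from arg_cong[OF this, of "h' 1"] have "day_class HZ HZ 1 (t 2 1) = day_class HZ HZ 1 (t 1 2)"
    by (simp only: h'[rule_format, OF obj])
  then have "row_weight 1 (t 2 1) = row_weight 1 (t 1 2)"
    by (intro row_weight_day_eq day_class_eqD elts) simp_all
  \<comment> \<open>Two rows of sum 1 against a single row of sum 2: the coefficients of [1] in 2[1]
    and in [2].\<close>
  moreover have "row_weight 1 (t 2 1) = 2" "row_weight 1 (t 1 2) = 0"
    by (simp_all add: t_def row_sum_def gfold_def ones_def spair_def two)
  ultimately show False by simp
qed

end
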